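(* Let $e=(e_j)_{1\le j\le d}$ and $e'=(e'_j)_{1\le j\le d}$ be two linear bases of $V$, and let $R:V\to V$ be the linear map defined by $Re_i=e'_i$ for all $1\le i\le d$. Then for all $n\in\mathbb{N}$, $n\geq 1$, and all $j\in\{1,\dots,d\}$, $$\Omega_n^{(e)}=(R^{\otimes n})^*\,\Omega_n^{(e')}\,R^{\otimes n},\qquad \alpha^{(e')}_{e'_j|n}=R^{\otimes n}\,\alpha^{(e)}_{e_j|n}\,(R^{\otimes n})^{-1}.$$
   Context: Let $d\in\mathbb{N}$, $d\ge 1$, and let $\mathcal{P}=\mathbb{C}[X_1,\dots,X_d]$ be the complex polynomial $*$-algebra in $d$ commuting indeterminates, with the involution for which each $X_j$ is self-adjoint. For $n\in\mathbb{N}$, $\mathcal{P}_{n]}$ denotes the linear span of all monomials of degree $\le n$, and $\mathcal{P}_{-1]}=\{0\}$. A state $\varphi$ on $\mathcal{P}$ (a linear functional with $\varphi(1)=1$ and $\varphi(a^*a)\ge 0$ for all $a\in\mathcal{P}$) is fixed. It defines the (possibly degenerate) pre-scalar product $\langle a,b\rangle=\varphi(a^*b)$. Associated with $\varphi$ is the $\varphi$-orthogonal polynomial decomposition, a vector space direct sum $\mathcal{P}=\bigoplus_{n\in\mathbb{N}}\mathcal{P}_n$ (algebraic, each element having finitely many nonzero components) such that: (i) $\mathcal{P}_m\perp\mathcal{P}_n$ for $\langle\cdot,\cdot\rangle$ whenever $m\ne n$; (ii) $\mathcal{P}_{n]}=\bigoplus_{h=0}^n\mathcal{P}_h$ for all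 $n$; (iii) each $\mathcal{P}_n\subset\mathcal{P}_{n]}$ is monic of degree $n$, i.e. $\mathcal{P}_{n]}=\mathcal{P}_{n-1]}\oplus\mathcal{P}_n$ (vector space direct sum) and $\mathcal{P}_n$ has a linear basis each of whose elements has as highest order term a multiple of a single monomial of degree $n$. Let $\langle\cdot,\cdot\rangle_{\mathcal{P}_n}$ be the restriction of $\langle\cdot,\cdot\rangle$ to $\mathcal{P}_n$, and $\Phi=1_{\mathcal{P}}$. Let $P_n:\mathcal{P}\to\mathcal{P}_n$ denote the projector onto $\mathcal{P}_n$ associated with this decomposition. For $1\le j\le d$ and $n\in\mathbb{N}$ put $a^+_{j|n}:=P_{n+1}X_jP_n|_{\mathcal{P}_n}:\mathcal{P}_n\to\mathcal{P}_{n+1}$ and $a^0_{j|n}:=P_nX_jP_n|_{\mathcal{P}_n}:\mathcal{P}_n\to\mathcal{P}_n$ (where $X_j$ acts by multiplication), and let $a^+_j=\sum_n a^+_{j|n}$ be the linear operator on $\mathcal{P}$ whose restriction to $\mathcal{P}_n$ is $a^+_{j|n}$. The operators $a_1^+,\dots,a_d^+$ commute. Let $V$ be a complex Hilbert space of dimension $d$ with scalar product $\langle\cdot,\cdot\rangle_V$. $V^{\hat\otimes n}$ is the $n$-th symmetric tensor power, $\hat\otimes$ the symmetrized tensor product, and $V^{\hat\otimes n}$ carries the scalar product determined by $\langle u^{\otimes n},v^{\otimes n}\rangle_{V^{\hat\otimes n}}=\langle u,v\rangle_V^n$ for $u,v\in V$. For a linear map $R$ on $V$, $R^{\otimes n}$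 denotes the induced operator on $V^{\hat\otimes n}$, and $^*$ denotes the adjoint for $\langle\cdot,\cdot\rangle_{V^{\hat\otimes n}}$. For a basis $e=(e_j)_{1\le j\le d}$ of $V$ and $v=\sum_{j}v_je_j$, put $a^+_{v,e}:=\sum_{j}v_ja^+_j$ (so $a^+_{e_j,e}=a^+_j$: the operators $a^+_j$, $a^0_{j|n}$ depend only on the coordinates $X_j$, and the basis vector $e_j$ is associated with the $j$-th one). Let $U_{n,e}:V^{\hat\otimes n}\to\mathcal{P}_n$ be the vector space isomorphism determined by $$U_{n,e}(v_n\hat\otimes\cdots\hat\otimes v_1)=a^+_{v_n,e}\cdots a^+_{v_1,e}\Phi .$$ The Jacobi sequences of $\varphi$ with respect to the basis $e$ are defined as follows: $\Omega_n^{(e)}$ is the linear operator on $V^{\hat\otimes n}$ with $$\langle \xi,\Omega_n^{(e)}\eta\rangle_{V^{\hat\otimes n}}=\langle U_{n,e}\xi,U_{n,e}\eta\rangle_{\mathcal{P}_n}\qquad(\xi,\eta\in V^{\hat\otimes n}),$$ and $\alpha^{(e)}_{e_j|n}:=U_{n,e}^{-1}\,a^0_{j|n}\,U_{n,e}$, a linear operator on $V^{\hat\otimes n}$, for $1\le j\le d$. The same definitions are used for the basis $e'$ with $e_j$ replaced by $e'_j$ (in particular $a^+_{e'_j,e'}=a^+_j$ and $\alpha^{(e')}_{e'_j|n}=U_{n,e'}^{-1}a^0_{j|n}U_{n,e'}$). *)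

theory Defs
  imports
    Complex_Main
    "HOL-Library.Cardinality"
    "HOL-Library.Poly_Mapping"
    "HOL-Library.Function_Algebras"
    "HOL-Library.FuncSet"
    "HOL-Library.Nonpos_Ints"
    "HOL-Combinatorics.Permutations"
begin

section \<open>Complex vector spaces and complex inner product spaces\<close>

class complex_vector = ab_group_add +
  fixes scaleC :: "complex \<Rightarrow> 'a \<Rightarrow> 'a"  (infixr \<open>*\<^sub>C\<close> 75)
  assumes scaleC_add_right: "a *\<^sub>C (x + y) = a *\<^sub>C x + a *\<^sub>C y"
    and scaleC_add_left: "(a + b) *\<^sub>C x = a *\<^sub>C x + b *\<^sub>C x"
    and scaleC_scaleC: "a *\<^sub>C b *\<^sub>C x = (a * b) *\<^sub>C x"
    and scaleC_one: "1 *\<^sub>C x = x"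

global_interpretation complex_vector:
  vector_space "scaleC :: complex \<Rightarrow> 'a \<Rightarrow> 'a::complex_vector"
  defines cdependent = complex_vector.dependent
    and crepresentation = complex_vector.representation
    and csubspace = complex_vector.subspace
    and cspan = complex_vector.span
    and cdim = complex_vector.dim
  by unfold_locales (auto simp: scaleC_add_right scaleC_add_left scaleC_scaleC scaleC_one)

abbreviation clinear :: "('a::complex_vector \<Rightarrow> 'b::complex_vector) \<Rightarrow> bool"
  where "clinear \<equiv> Vector_Spaces.linear scaleC scaleC"

instantiation complex :: complex_vector
begin
definition "scaleC c (z::complex) = c * z"
instance
  by standard (auto simp: scaleC_complex_def algebra_simps)
end

instantiation "fun" :: (type, complex_vector) complex_vector
begin
definition "scaleC c f = (\<lambda>x. c *\<^sub>C f x)"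
instance
  by standard (auto simp: scaleC_fun_def fun_eq_iff scaleC_add_right scaleC_add_left
      scaleC_scaleC scaleC_one)
end

instantiation poly_mapping :: (type, complex_vector) complex_vector
begin
definition "scaleC c p = Poly_Mapping.map (scaleC c) p"

lemma lookup_scaleC [simp]: "Poly_Mapping.lookup (c *\<^sub>C p) k = c *\<^sub>C Poly_Mapping.lookup p k"
  by (simp add: scaleC_poly_mapping_def map.rep_eq when_def complex_vector.scale_zero_right)

instance
  by standard (auto intro!: poly_mapping_eqI
      simp: Poly_Mapping.lookup_add scaleC_add_right scaleC_add_left scaleC_scaleC scaleC_one)
end

text \<open>The inner product is antilinear in its first argument. Completeness is not
  an axiom: only finite-dimensional spaces are used below.\<close>

class complex_inner = complex_vector +
  fixes cinner :: "'a \<Rightarrow> 'a \<Rightarrow> complex"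
  assumes cinner_add_right: "cinner x (y + z) = cinner x y + cinner x z"
    and cinner_scaleC_right: "cinner x (c *\<^sub>C y) = c * cinner x y"
    and cinner_commute: "cinner x y = cnj (cinner y x)"
    and cinner_nonneg: "cinner x x \<in> \<real>\<^sub>\<ge>\<^sub>0"
    and cinner_eq_zero_iff: "cinner x x = 0 \<longleftrightarrow> x = 0"

definition is_basis :: "('d::finite \<Rightarrow> 'v::complex_vector) \<Rightarrow> bool" where
  "is_basis e \<longleftrightarrow> inj e \<and> \<not> cdependent (range e) \<and> cspan (range e) = UNIV"

definition coord :: "('d::finite \<Rightarrow> 'v::complex_vector) \<Rightarrow> 'v \<Rightarrow> 'd \<Rightarrow> complex" where
  "coord e v j = crepresentation (range e) v (e j)"

definition clinear_on ::
    "'a::complex_vector set \<Rightarrow> 'b::complex_vector set \<Rightarrow> ('a \<Rightarrow> 'b) \<Rightarrow> bool" where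
  "clinear_on S T f \<longleftrightarrow> f \<in> S \<rightarrow> T \<and>
     (\<forall>x\<in>S. \<forall>y\<in>S. f (x + y) = f x + f y) \<and> (\<forall>c. \<forall>x\<in>S. f (c *\<^sub>C x) = c *\<^sub>C f x)"

definition sesquilinear_on ::
    "'a::complex_vector set \<Rightarrow> ('a \<Rightarrow> 'a \<Rightarrow> complex) \<Rightarrow> bool" where
  "sesquilinear_on S B \<longleftrightarrow>
     (\<forall>x\<in>S. \<forall>y\<in>S. \<forall>z\<in>S. B (x + y) z = B x z + B y z \<and> B z (x + y) = B z x + B z y) \<and>
     (\<forall>c. \<forall>x\<in>S. \<forall>y\<in>S. B (c *\<^sub>C x) y = cnj c * B x y \<and> B x (c *\<^sub>C y) = c * B x y)"

definition is_decomp ::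
    "'i set \<Rightarrow> ('i \<Rightarrow> 'a::complex_vector set) \<Rightarrow> 'a \<Rightarrow> ('i \<Rightarrow> 'a) \<Rightarrow> bool" where
  "is_decomp I F x c \<longleftrightarrow> (\<forall>i\<in>I. c i \<in> F i) \<and> (\<forall>i. i \<notin> I \<longrightarrow> c i = 0) \<and>
     finite {i. c i \<noteq> 0} \<and> x = (\<Sum>i | c i \<noteq> 0. c i)"

definition is_direct_sum ::
    "'a::complex_vector set \<Rightarrow> 'i set \<Rightarrow> ('i \<Rightarrow> 'a set) \<Rightarrow> bool" where
  "is_direct_sum S I F \<longleftrightarrow> csubspace S \<and> (\<forall>i\<in>I. csubspace (F i) \<and> F i \<subseteq> S) \<and>
     (\<forall>x\<in>S. \<exists>!c. is_decomp I F x c)"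


section \<open>Polynomials\<close>

text \<open>Monomials are exponent vectors; the type \<open>'d\<close> indexes the indeterminates.\<close>

type_synonym 'd cpoly = "('d \<Rightarrow>\<^sub>0 nat) \<Rightarrow>\<^sub>0 complex"

definition monomial_degree :: "('d::finite \<Rightarrow>\<^sub>0 nat) \<Rightarrow> nat" where
  "monomial_degree m = (\<Sum>j\<in>UNIV. Poly_Mapping.lookup m j)"

definition monomial :: "('d \<Rightarrow>\<^sub>0 nat) \<Rightarrow> 'd cpoly" where
  "monomial m = Poly_Mapping.single m 1"

definition indet :: "'d \<Rightarrow> 'd cpoly" where
  "indet j = monomial (Poly_Mapping.single j 1)"

definition poly_star :: "'d cpoly \<Rightarrow> 'd cpoly" where
  "poly_star p = Poly_Mapping.map cnj p"

text \<open>The integer index makes \<open>poly_upto (- 1) = {0}\<close> meaningful.\<close>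

definition poly_upto :: "int \<Rightarrow> 'd::finite cpoly set" where
  "poly_upto k = cspan {monomial m | m. int (monomial_degree m) \<le> k}"

definition is_state :: "('d::finite cpoly \<Rightarrow> complex) \<Rightarrow> bool" where
  "is_state \<phi> \<longleftrightarrow> clinear \<phi> \<and> \<phi> 1 = 1 \<and> (\<forall>a. \<phi> (poly_star a * a) \<in> \<real>\<^sub>\<ge>\<^sub>0)"

definition pre_inner :: "('d::finite cpoly \<Rightarrow> complex) \<Rightarrow> 'd cpoly \<Rightarrow> 'd cpoly \<Rightarrow> complex" where
  "pre_inner \<phi> a b = \<phi> (poly_star a * b)"

definition is_monic_of_degree :: "nat \<Rightarrow> 'd::finite cpoly set \<Rightarrow> bool" where
  "is_monic_of_degree n Q \<longleftrightarrow>
     csubspace Q \<and> Q \<subseteq> poly_upto (int n) \<and>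
     poly_upto (int n - 1) \<inter> Q = {0} \<and>
     poly_upto (int n) = {a + b | a b. a \<in> poly_upto (int n - 1) \<and> b \<in> Q} \<and>
     (\<exists>B. B \<subseteq> Q \<and> \<not> cdependent B \<and> cspan B = Q \<and>
        (\<forall>b\<in>B. \<exists>m c. monomial_degree m = n \<and> c \<noteq> 0 \<and>
           b - c *\<^sub>C monomial m \<in> poly_upto (int n - 1)))"

definition is_orthogonal_decomposition ::
    "('d::finite cpoly \<Rightarrow> complex) \<Rightarrow> (nat \<Rightarrow> 'd cpoly set) \<Rightarrow> bool" where
  "is_orthogonal_decomposition \<phi> P \<longleftrightarrow>
     is_direct_sum UNIV UNIV P \<and>
     (\<forall>m n. m \<noteq> n \<longrightarrow> (\<forall>a\<in>P m. \<forall>b\<in>P n. pre_inner \<phi> a b = 0)) \<and>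
     (\<forall>n. is_direct_sum (poly_upto (int n)) {..n} P) \<and>
     (\<forall>n. is_monic_of_degree n (P n))"

definition decomp_proj :: "(nat \<Rightarrow> 'd::finite cpoly set) \<Rightarrow> nat \<Rightarrow> 'd cpoly \<Rightarrow> 'd cpoly" where
  "decomp_proj P n p = (THE c. is_decomp UNIV P p c) n"

definition a_plus_n ::
    "(nat \<Rightarrow> 'd::finite cpoly set) \<Rightarrow> 'd \<Rightarrow> nat \<Rightarrow> 'd cpoly \<Rightarrow> 'd cpoly" where
  "a_plus_n P j n p = decomp_proj P (Suc n) (indet j * decomp_proj P n p)"

definition a_zero_n ::
    "(nat \<Rightarrow> 'd::finite cpoly set) \<Rightarrow> 'd \<Rightarrow> nat \<Rightarrow> 'd cpoly \<Rightarrow> 'd cpoly" where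
  "a_zero_n P j n p = decomp_proj P n (indet j * decomp_proj P n p)"

definition a_plus :: "(nat \<Rightarrow> 'd::finite cpoly set) \<Rightarrow> 'd \<Rightarrow> 'd cpoly \<Rightarrow> 'd cpoly" where
  "a_plus P j p = (\<Sum>n | decomp_proj P n p \<noteq> 0. a_plus_n P j n p)"

definition a_plus_vec ::
    "(nat \<Rightarrow> 'd::finite cpoly set) \<Rightarrow> ('d \<Rightarrow> 'v::complex_vector) \<Rightarrow> 'v \<Rightarrow> 'd cpoly \<Rightarrow> 'd cpoly"
  where "a_plus_vec P e v p = (\<Sum>j\<in>UNIV. coord e v j *\<^sub>C a_plus P j p)"


section \<open>Symmetric tensor powers\<close>

text \<open>As usual for Hilbert spaces, the simple tensor \<open>v\<^sub>1 \<otimes> \<dots> \<otimes> v\<^sub>n\<close> is realised as the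
  conjugate-multilinear form \<open>(w\<^sub>1, \<dots>, w\<^sub>n) \<mapsto> \<langle>w\<^sub>1, v\<^sub>1\<rangle> \<dots> \<langle>w\<^sub>n, v\<^sub>n\<rangle>\<close>; an \<open>n\<close>-tuple is a list
  of length \<open>n\<close>, and the form is extended by \<open>0\<close> to lists of other lengths.\<close>

type_synonym 'v tensor = "'v list \<Rightarrow> complex"

definition tensor :: "'v::complex_inner list \<Rightarrow> 'v tensor" where
  "tensor vs ws =
     (if length ws = length vs then \<Prod>i<length vs. cinner (ws ! i) (vs ! i) else 0)"

text \<open>The normalisation makes \<open>u \<otimes> \<dots> \<otimes> u\<close> its own symmetrisation.\<close>

definition sym_tensor :: "'v::complex_inner list \<Rightarrow> 'v tensor" where
  "sym_tensor vs =
     (1 / fact (length vs)) *\<^sub>C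
       (\<Sum>\<sigma> | \<sigma> permutes {..<length vs}. tensor (permute_list \<sigma> vs))"

definition sym_power :: "nat \<Rightarrow> 'v::complex_inner tensor set" where
  "sym_power n = cspan {sym_tensor vs | vs. length vs = n}"

definition sym_inner :: "nat \<Rightarrow> 'v::complex_inner tensor \<Rightarrow> 'v tensor \<Rightarrow> complex" where
  "sym_inner n = (THE B.
     (\<forall>\<xi> \<eta>. \<xi> \<notin> sym_power n \<or> \<eta> \<notin> sym_power n \<longrightarrow> B \<xi> \<eta> = 0) \<and>
     sesquilinear_on (sym_power n) B \<and>
     (\<forall>u v. B (tensor (replicate n u)) (tensor (replicate n v)) = cinner u v ^ n))"

definition sym_lift ::
    "nat \<Rightarrow> ('v::complex_inner list \<Rightarrow> 'w::complex_vector) \<Rightarrow> 'v tensor \<Rightarrow> 'w" where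
  "sym_lift n g = (THE f. f \<in> extensional (sym_power n) \<and>
     clinear_on (sym_power n) UNIV f \<and> (\<forall>vs. length vs = n \<longrightarrow> f (sym_tensor vs) = g vs))"

definition sym_map ::
    "nat \<Rightarrow> ('v::complex_inner \<Rightarrow> 'v) \<Rightarrow> 'v tensor \<Rightarrow> 'v tensor" where
  "sym_map n R = sym_lift n (\<lambda>vs. sym_tensor (map R vs))"

definition sym_adjoint ::
    "nat \<Rightarrow> ('v::complex_inner tensor \<Rightarrow> 'v tensor) \<Rightarrow> 'v tensor \<Rightarrow> 'v tensor" where
  "sym_adjoint n T = (THE T'. T' \<in> extensional (sym_power n) \<and>
     clinear_on (sym_power n) (sym_power n) T' \<and>
     (\<forall>\<xi>\<in>sym_power n. \<forall>\<eta>\<in>sym_power n. sym_inner n (T \<xi>) \<eta> = sym_inner n \<xi> (T' \<eta>)))"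


section \<open>Jacobi sequences\<close>

text \<open>The list argument \<open>[v\<^sub>n, \<dots>, v\<^sub>1]\<close> is mapped to \<open>a\<^sup>+ v\<^sub>n (\<dots> (a\<^sup>+ v\<^sub>1 1))\<close>.\<close>

definition jacobi_U ::
    "(nat \<Rightarrow> 'd::finite cpoly set) \<Rightarrow> nat \<Rightarrow> ('d \<Rightarrow> 'v::complex_inner) \<Rightarrow> 'v tensor \<Rightarrow> 'd cpoly"
  where "jacobi_U P n e = sym_lift n (\<lambda>vs. foldr (a_plus_vec P e) vs 1)"

definition jacobi_Omega ::
    "('d::finite cpoly \<Rightarrow> complex) \<Rightarrow> (nat \<Rightarrow> 'd cpoly set) \<Rightarrow> nat \<Rightarrow>
     ('d \<Rightarrow> 'v::complex_inner) \<Rightarrow> 'v tensor \<Rightarrow> 'v tensor" where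
  "jacobi_Omega \<phi> P n e = (THE T. T \<in> extensional (sym_power n) \<and>
     clinear_on (sym_power n) (sym_power n) T \<and>
     (\<forall>\<xi>\<in>sym_power n. \<forall>\<eta>\<in>sym_power n.
        sym_inner n \<xi> (T \<eta>) = pre_inner \<phi> (jacobi_U P n e \<xi>) (jacobi_U P n e \<eta>)))"

definition jacobi_alpha ::
    "(nat \<Rightarrow> 'd::finite cpoly set) \<Rightarrow> nat \<Rightarrow> ('d \<Rightarrow> 'v::complex_inner) \<Rightarrow> 'd \<Rightarrow>
     'v tensor \<Rightarrow> 'v tensor" where
  "jacobi_alpha P n e j \<xi> = inv_into (sym_power n) (jacobi_U P n e) (a_zero_n P j n (jacobi_U P n e \<xi>))"

end

theory Submission
  imports Defs
begin

text \<open>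
  Both identities express that the polynomial side of the construction does not know the basis. The
  map \<open>R\<close> preserves coordinates, \<open>coord e' (R v) = coord e v\<close>, so the creation operator attached to
  \<open>v\<close> by \<open>e\<close> is the one attached to \<open>R v\<close> by \<open>e'\<close>, and therefore \<open>U e = U e' \<circ> R\<^sup>\<otimes>\<^sup>n\<close>
  (\<open>jacobi_U_change_basis\<close>). Then
  \<open>\<langle>\<xi>, \<Omega> \<eta>\<rangle> = \<langle>U e \<xi>, U e \<eta>\<rangle> = \<langle>U e' (R\<^sup>\<otimes>\<^sup>n \<xi>), U e' (R\<^sup>\<otimes>\<^sup>n \<eta>)\<rangle> = \<langle>R\<^sup>\<otimes>\<^sup>n \<xi>, \<Omega>' R\<^sup>\<otimes>\<^sup>n \<eta>\<rangle>\<close>,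
  and nondegeneracy of the scalar product gives the first identity; conjugating the operator
  \<open>a\<^sup>0\<close> by the two isomorphisms gives the second.

  The work lies in showing that the objects involved exist, since the symmetric scalar product, \<open>U\<close>,
  \<open>R\<^sup>\<otimes>\<^sup>n\<close>, adjoints and \<open>\<Omega>\<close> are given by characterising properties only.

  On the tensor side everything follows from one formula. For a basis \<open>e\<close> with dual basis \<open>f\<close>, a
  symmetric multilinear \<open>g\<close> satisfies
  \<open>g (v\<^sub>1, \<dots>, v\<^sub>n) = \<Sum> sym_tensor (v\<^sub>1, \<dots>, v\<^sub>n) (f\<^sub>j, \<dots>, f\<^sub>k) g (e\<^sub>j, \<dots>, e\<^sub>k)\<close>
  (\<open>symmetric_multilinear_expansion\<close>). It provides the linear extension of \<open>g\<close> explicitly, and from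
  it the scalar product, which has the reproducing property \<open>\<langle>sym_tensor vs, \<eta>\<rangle> = \<eta> vs\<close>
  (\<open>sym_inner_sym_tensor_left\<close>), and the operator representing a given sesquilinear form
  (\<open>ex1_operator_of_sesquilinear\<close>). Uniqueness of the scalar product needs that the powers
  \<open>u \<otimes> \<dots> \<otimes> u\<close> span, which is polarization.

  On the polynomial side the creation operators commute and
  \<open>a\<^sup>+\<^sub>j \<dots> a\<^sup>+\<^sub>k 1\<close> equals \<open>X\<^sub>j \<dots> X\<^sub>k\<close> up to terms of lower degree
  (\<open>a_plus_commute\<close>, \<open>foldr_a_plus_congruent\<close>). The first fact makes \<open>U\<close> well defined, the second
  makes it a bijection onto \<open>P n\<close> (\<open>bij_betw_jacobi_U\<close>); this is needed because \<open>\<alpha>\<close> involves its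
  inverse.
\<close>

section \<open>Linear maps on subspaces\<close>

lemma clinear_iff:
  "clinear f \<longleftrightarrow> (\<forall>x y. f (x + y) = f x + f y) \<and> (\<forall>c x. f (c *\<^sub>C x) = c *\<^sub>C f x)"
  by (simp add: Vector_Spaces.linear_iff complex_vector.vector_space_axioms)

lemma clinearI:
  assumes "\<And>x y. f (x + y) = f x + f y" and "\<And>c x. f (c *\<^sub>C x) = c *\<^sub>C f x"
  shows "clinear f"
  using assms by (simp add: clinear_iff)

lemma clinear_add: "clinear f \<Longrightarrow> f (x + y) = f x + f y"
  and clinear_scaleC: "clinear f \<Longrightarrow> f (c *\<^sub>C x) = c *\<^sub>C f x"
  by (simp_all add: clinear_iff)

lemma clinear_zero: "clinear f \<Longrightarrow> f 0 = 0"
  using clinear_scaleC[of f 0 0] by simp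

lemma clinear_diff: "clinear f \<Longrightarrow> f (x - y) = f x - f y"
  using clinear_add[of f "x - y" y] by simp

lemma clinear_sum: "clinear f \<Longrightarrow> f (\<Sum>i\<in>A. g i) = (\<Sum>i\<in>A. f (g i))"
  by (induction A rule: infinite_finite_induct) (auto simp: clinear_zero clinear_add)

lemma clinear_compose: "clinear f \<Longrightarrow> clinear g \<Longrightarrow> clinear (\<lambda>x. f (g x))"
  by (simp add: clinear_iff)

lemma clinear_sumI:
  assumes "\<And>i. i \<in> A \<Longrightarrow> clinear (h i)"
  shows "clinear (\<lambda>x. \<Sum>i\<in>A. c i *\<^sub>C h i x)"
  using assms
  by (induction A rule: infinite_finite_induct)
    (auto simp: clinear_iff scaleC_add_right algebra_simps scaleC_scaleC)

lemma clinear_on_imp_mem: "clinear_on S T f \<Longrightarrow> x \<in> S \<Longrightarrow> f x \<in> T"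
  by (auto simp: clinear_on_def)

lemma clinear_on_add: "clinear_on S T f \<Longrightarrow> x \<in> S \<Longrightarrow> y \<in> S \<Longrightarrow> f (x + y) = f x + f y"
  and clinear_on_scaleC: "clinear_on S T f \<Longrightarrow> x \<in> S \<Longrightarrow> f (c *\<^sub>C x) = c *\<^sub>C f x"
  by (auto simp: clinear_on_def)

lemma clinear_on_compose:
  assumes "clinear_on S T f" "clinear_on T W g"
  shows "clinear_on S W (\<lambda>x. g (f x))"
  using assms by (auto simp: clinear_on_def Pi_iff)

lemma clinear_on_sum:
  assumes f: "clinear_on S T f" and S: "csubspace S" and g: "\<And>i. i \<in> A \<Longrightarrow> g i \<in> S"
  shows "f (\<Sum>i\<in>A. c i *\<^sub>C g i) = (\<Sum>i\<in>A. c i *\<^sub>C f (g i))"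
proof -
  have 0: "f 0 = 0"
    using clinear_on_scaleC[OF f complex_vector.subspace_0[OF S], of 0] by simp
  show ?thesis
    using g
  proof (induction A rule: infinite_finite_induct)
    case (insert x A)
    have "(\<Sum>i\<in>A. c i *\<^sub>C g i) \<in> S"
      using insert.prems by (intro complex_vector.subspace_sum[OF S] complex_vector.subspace_scale[OF S]) auto
    then show ?case
      using insert f S
      by (simp add: clinear_on_add[OF f] clinear_on_scaleC[OF f] complex_vector.subspace_scale)
  qed (simp_all add: 0)
qed

lemma clinear_on_span_eq:
  assumes "clinear_on (cspan G) T f" "clinear_on (cspan G) T' g"
    and "\<And>x. x \<in> G \<Longrightarrow> f x = g x" and "\<xi> \<in> cspan G"
  shows "f \<xi> = g \<xi>"
proof -
  have "\<xi> \<in> cspan G \<and> f \<xi> = g \<xi>"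
    using assms(4)
  proof (induction rule: complex_vector.span_induct_alt)
    case base
    show ?case
      using clinear_on_scaleC[OF assms(1) complex_vector.span_zero, of 0]
        clinear_on_scaleC[OF assms(2) complex_vector.span_zero, of 0]
      by (simp add: complex_vector.span_zero)
  next
    case (step c x y)
    then show ?case
      using assms(3) clinear_on_add[OF assms(1)] clinear_on_scaleC[OF assms(1)]
        clinear_on_add[OF assms(2)] clinear_on_scaleC[OF assms(2)]
      by (simp add: complex_vector.span_base complex_vector.span_add complex_vector.span_scale)
  qed
  then show ?thesis by simp
qed

lemma sum_fun_apply: "(\<Sum>i\<in>A. f i) x = (\<Sum>i\<in>A. f i x)" for f :: "'i \<Rightarrow> 'a \<Rightarrow> 'b::comm_monoid_add"
  by (induction A rule: infinite_finite_induct) auto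

lemma scaleC_fun_apply: "(c *\<^sub>C f) x = c *\<^sub>C f x" for f :: "'a \<Rightarrow> 'b::complex_vector"
  by (simp add: scaleC_fun_def)

lemma clinear_fun_iff: "clinear f \<longleftrightarrow> (\<forall>y. clinear (\<lambda>x. f x y))"
  for f :: "'a::complex_vector \<Rightarrow> 'c \<Rightarrow> 'b::complex_vector"
  by (auto simp: clinear_iff fun_eq_iff scaleC_fun_apply)

section \<open>Dual families\<close>

lemma clinear_cinner: "clinear (cinner w)"
  by (intro clinearI) (simp_all add: cinner_add_right cinner_scaleC_right scaleC_complex_def)

text \<open>In coordinates \<open>v\<^sub>j = \<langle>f\<^sub>j, v\<rangle>\<close> every vector is \<open>\<Sum>\<^sub>j v\<^sub>j e\<^sub>j\<close>. Writing coordinates as scalar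
  products is what fits the realisation of tensors as forms: the coordinates of a tensor \<open>\<xi>\<close> are then
  simply its values at tuples of vectors \<open>f\<^sub>j\<close>.\<close>

locale dual_pair =
  fixes e f :: "'d::finite \<Rightarrow> 'v::complex_inner"
  assumes expansion: "v = (\<Sum>j\<in>UNIV. cinner (f j) v *\<^sub>C e j)"

lemma coord_clinear:
  assumes "is_basis e"
  shows "clinear (\<lambda>v. coord e v j)"
  using assms
  by (intro clinearI)
    (auto simp: is_basis_def coord_def complex_vector.representation_add
      complex_vector.representation_scale scaleC_complex_def)

lemma coord_basis:
  assumes "is_basis e"
  shows "coord e (e i) j = (if i = j then 1 else 0)"
  using assms
  by (auto simp: is_basis_def coord_def complex_vector.representation_basis dest: injD)

lemma coord_expansion:
  assumes "is_basis e"
  shows "v = (\<Sum>j\<in>UNIV. coord e v j *\<^sub>C e j)"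
proof -
  have e: "inj e" "\<not> cdependent (range e)" "v \<in> cspan (range e)"
    using assms by (auto simp: is_basis_def)
  have "v = (\<Sum>b\<in>range e. crepresentation (range e) v b *\<^sub>C b)"
    using complex_vector.sum_representation_eq[OF e(2,3), of "range e"] by simp
  also have "\<dots> = (\<Sum>j\<in>UNIV. coord e v j *\<^sub>C e j)"
    by (subst sum.reindex[OF e(1)]) (simp add: coord_def)
  finally show ?thesis .
qed

text \<open>The dual basis comes from \<open>w \<mapsto> \<Sum>\<^sub>j \<langle>e\<^sub>j, w\<rangle> e\<^sub>j\<close>, which is linear and injective because the scalar
  product is definite, hence onto by finite dimension: a preimage of \<open>e\<^sub>j\<close> can serve as \<open>f\<^sub>j\<close>.\<close>

lemma ex_dual_pair:
  fixes e :: "'d::finite \<Rightarrow> 'v::complex_inner"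
  assumes e: "is_basis e"
  obtains f where "dual_pair e f" "\<And>v j. cinner (f j) v = coord e v j"
proof -
  interpret fd: finite_dimensional_vector_space "scaleC :: complex \<Rightarrow> 'v \<Rightarrow> 'v" "range e"
    using e by unfold_locales (auto simp: is_basis_def cdependent_def cspan_def)
  define A where "A w = (\<Sum>j\<in>UNIV. cinner (e j) w *\<^sub>C e j)" for w
  have A: "clinear A"
    unfolding A_def
    by (intro clinearI)
      (simp_all add: cinner_add_right cinner_scaleC_right scaleC_add_left sum.distrib
        complex_vector.scale_sum_right)
  have coordA: "coord e (A w) i = cinner (e i) w" for w i
    unfolding A_def
    by (simp add: clinear_sum[OF coord_clinear[OF e]] clinear_scaleC[OF coord_clinear[OF e]]
        coord_basis[OF e] scaleC_complex_def if_distrib cong: if_cong)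
  have "inj A"
  proof (rule injI)
    fix x y
    assume "A x = A y"
    then have eq: "cinner (e i) (x - y) = 0" for i
      using coordA[of x i] coordA[of y i] by (simp add: clinear_diff[OF clinear_cinner])
    have "cinner (x - y) (x - y) = (\<Sum>i\<in>UNIV. coord e (x - y) i * cinner (x - y) (e i))"
      by (subst (2) coord_expansion[OF e, of "x - y"])
        (simp add: clinear_sum[OF clinear_cinner] cinner_scaleC_right)
    also have "\<dots> = 0"
    proof (rule sum.neutral, rule ballI)
      fix i
      have "cinner (x - y) (e i) = cnj (cinner (e i) (x - y))" by (rule cinner_commute)
      then show "coord e (x - y) i * cinner (x - y) (e i) = 0" by (simp add: eq)
    qed
    finally show "x = y" by (simp add: cinner_eq_zero_iff)
  qed
  then have "surj A"
    using A fd.linear_inj_imp_surj by blast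
  define f where "f i = inv A (e i)" for i
  have f: "A (f i) = e i" for i
    unfolding f_def using \<open>surj A\<close> by (rule surj_f_inv_f)
  have "cinner (f j) v = coord e v j" for v j
  proof -
    have dual: "cinner (f j) (e i) = (if i = j then 1 else 0)" for i
      using coordA[of "f j" i] coord_basis[OF e, of j i] cinner_commute[of "f j" "e i"]
      by (auto simp: f)
    then show ?thesis
      by (subst (1) coord_expansion[OF e, of v])
        (simp add: clinear_sum[OF clinear_cinner] cinner_scaleC_right dual if_distrib
          cong: if_cong)
  qed
  with that[of f] coord_expansion[OF e] show thesis
    by (simp add: dual_pair_def)
qed

section \<open>Symmetric multilinear maps\<close>

text \<open>Functions of \<open>n\<close> vectors take lists, and only their values on lists of length \<open>n\<close> are constrained.\<close>

definition multilinear :: "nat \<Rightarrow> ('v::complex_vector list \<Rightarrow> 'w::complex_vector) \<Rightarrow> bool" where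
  "multilinear n g \<longleftrightarrow>
     (\<forall>xs ys. length xs + length ys + 1 = n \<longrightarrow> clinear (\<lambda>v. g (xs @ v # ys)))"

definition symmetric :: "nat \<Rightarrow> ('v list \<Rightarrow> 'w) \<Rightarrow> bool" where
  "symmetric n g \<longleftrightarrow> (\<forall>vs ws. length vs = n \<longrightarrow> mset vs = mset ws \<longrightarrow> g vs = g ws)"

lemma multilinearD:
  "multilinear n g \<Longrightarrow> length xs + length ys + 1 = n \<Longrightarrow> clinear (\<lambda>v. g (xs @ v # ys))"
  by (simp add: multilinear_def)

lemma symmetricD: "symmetric n g \<Longrightarrow> mset vs = mset ws \<Longrightarrow> length vs = n \<Longrightarrow> g vs = g ws"
  by (auto simp: symmetric_def)

lemma symmetric_iff_permute:
  "symmetric n g \<longleftrightarrow>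
     (\<forall>vs \<sigma>. length vs = n \<longrightarrow> \<sigma> permutes {..<n} \<longrightarrow> g (permute_list \<sigma> vs) = g vs)"
  (is "_ \<longleftrightarrow> ?R")
proof
  show "symmetric n g \<Longrightarrow> ?R"
    by (metis symmetric_def length_permute_list mset_permute_list)
  assume R: ?R
  show "symmetric n g"
    unfolding symmetric_def
  proof (intro allI impI)
    fix vs ws :: "'a list"
    assume *: "length vs = n" "mset vs = mset ws"
    then have l: "length ws = n" by (metis size_mset)
    obtain p where "p permutes {..<length ws}" "permute_list p ws = vs"
      using mset_eq_permutation[OF *(2)] by blast
    with R l show "g vs = g ws" by auto
  qed
qed

lemma tensor_Nil: "tensor [] [] = 1"
  by (simp add: tensor_def)

lemma tensor_Cons: "tensor (v # vs) (w # ws) = cinner w v * tensor vs ws"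
  by (simp add: tensor_def prod.lessThan_Suc_shift del: prod.lessThan_Suc)

lemma tensor_length: "length ws \<noteq> length vs \<Longrightarrow> tensor vs ws = 0"
  by (simp add: tensor_def)

lemma tensor_append:
  "length ws = length vs \<Longrightarrow> tensor (vs @ vs') (ws @ ws') = tensor vs ws * tensor vs' ws'"
  by (induction ws vs rule: list_induct2) (simp_all add: tensor_Nil tensor_Cons)

lemma tensor_hermitian: "cnj (tensor vs ws) = tensor ws vs"
  by (auto simp: tensor_def intro!: prod.cong cinner_commute[symmetric])

lemma tensor_permute_list:
  assumes "\<sigma> permutes {..<length vs}" "length ws = length vs"
  shows "tensor (permute_list \<sigma> vs) (permute_list \<sigma> ws) = tensor vs ws"
proof -
  have "(\<Prod>i<length vs. cinner (permute_list \<sigma> ws ! i) (permute_list \<sigma> vs ! i)) =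
    (\<Prod>i<length vs. cinner (ws ! \<sigma> i) (vs ! \<sigma> i))"
    using assms by (intro prod.cong) (simp_all add: permute_list_nth)
  also have "\<dots> = (\<Prod>i<length vs. cinner (ws ! i) (vs ! i))"
    using prod.permute[OF assms(1), of "\<lambda>i. cinner (ws ! i) (vs ! i)"] by (simp add: o_def)
  finally show ?thesis using assms by (simp add: tensor_def)
qed

lemma multilinear_tensor: "multilinear n tensor"
  unfolding multilinear_def clinear_fun_iff
proof (intro allI impI)
  fix xs ys ws :: "'v::complex_inner list"
  show "clinear (\<lambda>v. tensor (xs @ v # ys) ws)"
  proof (cases "length ws = length xs + length ys + 1")
    case False
    then show ?thesis by (simp add: tensor_length clinear_iff)
  next
    case True
    then have "length (drop (length xs) ws) = Suc (length ys)" by simp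
    then obtain w us where us: "drop (length xs) ws = w # us"
      by (metis length_Suc_conv)
    define ts where "ts = take (length xs) ws"
    have "ws = ts @ w # us"
      using append_take_drop_id[of "length xs" ws] by (simp add: us ts_def)
    moreover have "length ts = length xs"
      using True by (simp add: ts_def)
    ultimately have "tensor (xs @ v # ys) ws = tensor xs ts * (cinner w v * tensor ys us)" for v
      by (simp add: tensor_append tensor_Cons)
    then show ?thesis
      by (simp add: clinear_iff cinner_add_right cinner_scaleC_right algebra_simps scaleC_complex_def)
  qed
qed

lemma sym_tensor_apply:
  "sym_tensor vs ws =
     1 / fact (length vs) * (\<Sum>\<sigma> | \<sigma> permutes {..<length vs}. tensor (permute_list \<sigma> vs) ws)"
  by (simp add: sym_tensor_def scaleC_fun_apply sum_fun_apply scaleC_complex_def)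

lemma sym_tensor_length: "length ws \<noteq> length vs \<Longrightarrow> sym_tensor vs ws = 0"
  by (simp add: sym_tensor_apply tensor_length)

text \<open>By definition the vectors are permuted; moving the permutation to the arguments makes the
  dependence on the vectors visibly multilinear and the form Hermitian.\<close>

lemma sym_tensor_apply':
  assumes "length ws = length vs"
  shows "sym_tensor vs ws =
     1 / fact (length vs) * (\<Sum>\<sigma> | \<sigma> permutes {..<length vs}. tensor vs (permute_list \<sigma> ws))"
proof -
  have "tensor (permute_list (inv \<sigma>) vs) ws = tensor vs (permute_list \<sigma> ws)"
    if \<sigma>: "\<sigma> permutes {..<length vs}" for \<sigma>
  proof -
    have "tensor (permute_list (inv \<sigma>) vs) ws =
        tensor (permute_list \<sigma> (permute_list (inv \<sigma>) vs)) (permute_list \<sigma> ws)"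
      using assms \<sigma> by (subst tensor_permute_list) auto
    also have "permute_list \<sigma> (permute_list (inv \<sigma>) vs) = vs"
      using \<sigma> by (simp flip: permute_list_compose add: permutes_inv_o)
    finally show ?thesis .
  qed
  then show ?thesis
    unfolding sym_tensor_apply
    by (subst sum_permutations_inverse) simp
qed

lemma sym_tensor_hermitian: "cnj (sym_tensor vs ws) = sym_tensor ws vs"
proof (cases "length ws = length vs")
  case True
  then show ?thesis by (simp add: sym_tensor_apply' sym_tensor_apply[of ws] tensor_hermitian)
next
  case False
  then show ?thesis by (simp add: sym_tensor_length)
qed

lemma sym_tensor_permute_list:
  assumes "\<tau> permutes {..<length vs}"
  shows "sym_tensor (permute_list \<tau> vs) = sym_tensor vs"
proof
  fix ws
  have "(\<Sum>\<sigma> | \<sigma> permutes {..<length vs}. tensor (permute_list \<sigma> vs) ws) =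
    (\<Sum>\<sigma> | \<sigma> permutes {..<length vs}. tensor (permute_list (\<tau> \<circ> \<sigma>) vs) ws)"
    by (rule setum_permutations_compose_left[OF assms])
  then show "sym_tensor (permute_list \<tau> vs) ws = sym_tensor vs ws"
    by (simp add: sym_tensor_apply permute_list_compose)
qed

lemma symmetric_sym_tensor: "symmetric n sym_tensor"
  by (simp add: symmetric_iff_permute sym_tensor_permute_list)

lemma multilinear_sym_tensor: "multilinear n sym_tensor"
  unfolding multilinear_def clinear_fun_iff
proof (intro allI impI)
  fix xs ys ws :: "'v::complex_inner list"
  assume n: "length xs + length ys + 1 = n"
  show "clinear (\<lambda>v. sym_tensor (xs @ v # ys) ws)"
  proof (cases "length ws = n")
    case False
    with n show ?thesis by (simp add: sym_tensor_length clinear_iff)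
  next
    case True
    have "clinear (\<lambda>v. \<Sum>\<sigma> | \<sigma> permutes {..<n}. (1 / fact n) *\<^sub>C tensor (xs @ v # ys) (permute_list \<sigma> ws))"
      using multilinearD[OF multilinear_tensor n] unfolding clinear_fun_iff
      by (intro clinear_sumI) blast
    then show ?thesis
      using n True by (simp add: sym_tensor_apply' scaleC_complex_def sum_distrib_left)
  qed
qed

lemma sum_lists_Suc:
  "(\<Sum>js | length js = Suc n. F js) = (\<Sum>j\<in>UNIV. \<Sum>js | length js = n. F (j # js))"
  for F :: "'d::finite list \<Rightarrow> 'a::comm_monoid_add"
proof -
  have "{js :: 'd list. length js = Suc n} = (\<lambda>(j, js). j # js) ` (UNIV \<times> {js. length js = n})"
    by (auto simp: length_Suc_conv)
  moreover have "inj_on (\<lambda>(j, js). j # js) (UNIV \<times> {js :: 'd list. length js = n})"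
    by (auto simp: inj_on_def)
  ultimately show ?thesis
    by (simp add: sum.reindex sum.cartesian_product case_prod_unfold)
qed

lemma finite_lists_eq: "finite {js :: 'd::finite list. length js = n}"
  using finite_lists_length_eq[of "UNIV :: 'd set" n] by simp

context dual_pair
begin

lemma multilinear_expansion:
  assumes "multilinear n g" "length vs = n"
  shows "g vs = (\<Sum>js | length js = n. tensor vs (map f js) *\<^sub>C g (map e js))"
proof -
  have "g (xs @ vs) =
      (\<Sum>js | length js = length vs. tensor vs (map f js) *\<^sub>C g (xs @ map e js))"
    if "length xs + length vs = n" for xs vs
    using that
  proof (induction vs arbitrary: xs)
    case Nil
    then show ?case by (simp add: tensor_Nil scaleC_one)
  next
    case (Cons v vs)
    have lin: "clinear (\<lambda>v. g (xs @ v # vs))"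
      using Cons.prems by (intro multilinearD[OF assms(1)]) simp
    have "g (xs @ v # vs) = (\<Sum>j\<in>UNIV. cinner (f j) v *\<^sub>C g ((xs @ [e j]) @ vs))"
      by (subst expansion[of v]) (simp add: clinear_sum[OF lin] clinear_scaleC[OF lin])
    also have "\<dots> = (\<Sum>j\<in>UNIV. \<Sum>js | length js = length vs.
        tensor (v # vs) (map f (j # js)) *\<^sub>C g (xs @ map e (j # js)))"
      using Cons.prems
      by (subst Cons.IH) (simp_all add: tensor_Cons complex_vector.scale_sum_right scaleC_scaleC)
    finally show ?case by (simp add: sum_lists_Suc)
  qed
  from this[of "[]" vs] assms(2) show ?thesis by simp
qed

text \<open>The coefficients \<open>\<langle>f\<^sub>j, v\<^sub>1\<rangle> \<dots> \<langle>f\<^sub>k, v\<^sub>n\<rangle>\<close> of the multilinear expansion are values of the form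
  \<open>v\<^sub>1 \<otimes> \<dots> \<otimes> v\<^sub>n\<close>. Averaging over the permutations of the vectors leaves \<open>g\<close> unchanged and
  replaces that form by its symmetrisation, so the right-hand side depends on the vectors only through
  their symmetric tensor product.\<close>

lemma symmetric_multilinear_expansion:
  assumes g: "multilinear n g" "symmetric n g" and vs: "length vs = n"
  shows "g vs = (\<Sum>js | length js = n. sym_tensor vs (map f js) *\<^sub>C g (map e js))"
proof -
  let ?S = "{\<sigma>. \<sigma> permutes {..<n}}"
  have card: "card ?S = fact n" by (simp add: card_permutations)
  have "g vs = (1 / fact n) *\<^sub>C (\<Sum>\<sigma>\<in>?S. g vs)"
    by (simp add: complex_vector.sum_constant_scale card scaleC_scaleC scaleC_one)
  also have "(\<Sum>\<sigma>\<in>?S. g vs) =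
      (\<Sum>\<sigma>\<in>?S. \<Sum>js | length js = n. tensor (permute_list \<sigma> vs) (map f js) *\<^sub>C g (map e js))"
  proof (rule sum.cong[OF refl])
    fix \<sigma> assume "\<sigma> \<in> ?S"
    then have "g vs = g (permute_list \<sigma> vs)"
      using g(2) vs by (simp add: symmetric_iff_permute)
    then show "g vs = (\<Sum>js | length js = n. tensor (permute_list \<sigma> vs) (map f js) *\<^sub>C g (map e js))"
      using multilinear_expansion[OF g(1), of "permute_list \<sigma> vs"] vs by simp
  qed
  also have "\<dots> = (\<Sum>js | length js = n. (\<Sum>\<sigma>\<in>?S. tensor (permute_list \<sigma> vs) (map f js)) *\<^sub>C g (map e js))"
    by (subst sum.swap) (simp add: complex_vector.scale_sum_left)
  also have "(1 / fact n) *\<^sub>C \<dots> = (\<Sum>js | length js = n. sym_tensor vs (map f js) *\<^sub>C g (map e js))"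
    using vs by (simp add: complex_vector.scale_sum_right scaleC_scaleC sym_tensor_apply)
  finally show ?thesis .
qed

end

section \<open>The symmetric power and its universal property\<close>

lemma csubspace_sym_power: "csubspace (sym_power n)"
  by (simp add: sym_power_def)

lemma sym_tensor_in_sym_power: "length vs = n \<Longrightarrow> sym_tensor vs \<in> sym_power n"
  unfolding sym_power_def by (intro complex_vector.span_base) auto

lemma sum_in_sym_power:
  "(\<And>i. i \<in> A \<Longrightarrow> g i \<in> sym_power n) \<Longrightarrow> (\<Sum>i\<in>A. c i *\<^sub>C g i) \<in> sym_power n"
  by (intro complex_vector.subspace_sum complex_vector.subspace_scale csubspace_sym_power)

lemma sym_power_induct [consumes 1, case_names zero step]:
  assumes "\<xi> \<in> sym_power n" "Q 0"
    and "\<And>c vs \<eta>. length vs = n \<Longrightarrow> Q \<eta> \<Longrightarrow> Q (c *\<^sub>C sym_tensor vs + \<eta>)"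
  shows "Q \<xi>"
  using assms(1) unfolding sym_power_def
proof (induction rule: complex_vector.span_induct_alt)
  case (step c x y)
  then obtain vs where "x = sym_tensor vs" "length vs = n" by blast
  then show ?case using assms(3)[of vs y c] step by blast
qed (fact assms(2))

lemma sym_power_length: "\<xi> \<in> sym_power n \<Longrightarrow> length vs \<noteq> n \<Longrightarrow> \<xi> vs = 0"
  by (induction rule: sym_power_induct) (auto simp: scaleC_fun_apply sym_tensor_length)

lemma multilinear_cnj_sym_power:
  assumes "\<xi> \<in> sym_power n"
  shows "multilinear n (\<lambda>ws. cnj (\<xi> ws))"
  using assms
proof (induction rule: sym_power_induct)
  case zero
  then show ?case by (simp add: multilinear_def clinear_iff)
next
  case (step c vs \<eta>)
  have "multilinear n (\<lambda>ws. sym_tensor ws vs)"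
    using multilinear_sym_tensor[of n] unfolding multilinear_def clinear_fun_iff by blast
  with step show ?case
    by (simp add: multilinear_def clinear_iff scaleC_fun_apply sym_tensor_hermitian
        scaleC_complex_def algebra_simps)
qed

lemma symmetric_sym_power:
  assumes "\<xi> \<in> sym_power n"
  shows "symmetric n \<xi>"
  using assms
proof (induction rule: sym_power_induct)
  case zero
  then show ?case by (simp add: symmetric_def)
next
  case (step c vs \<eta>)
  have "sym_tensor vs ws = sym_tensor vs ws'" if "length ws = n" "mset ws = mset ws'" for ws ws'
    using symmetricD[OF symmetric_sym_tensor that(2,1)] sym_tensor_hermitian[of ws vs]
      sym_tensor_hermitian[of ws' vs] by simp
  moreover have "\<eta> ws = \<eta> ws'" if "length ws = n" "mset ws = mset ws'" for ws ws'
    using symmetricD[OF step(2) that(2,1)] .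
  ultimately show ?case
    by (auto simp: symmetric_def scaleC_fun_apply)
qed

lemma sym_power_clinear_eq:
  assumes "clinear_on (sym_power n) T F" "clinear_on (sym_power n) T' G"
    and "\<And>vs. length vs = n \<Longrightarrow> F (sym_tensor vs) = G (sym_tensor vs)"
    and "\<xi> \<in> sym_power n"
  shows "F \<xi> = G \<xi>"
  using clinear_on_span_eq[of "{sym_tensor vs | vs. length vs = n}" T F T' G \<xi>] assms
  by (auto simp: sym_power_def)

lemma clinear_on_restrict: "clinear_on S T F \<Longrightarrow> csubspace S \<Longrightarrow> clinear_on S T (restrict F S)"
  by (auto simp: clinear_on_def complex_vector.subspace_add complex_vector.subspace_scale)

context dual_pair
begin

lemma clinear_on_dual_expansion:
  assumes "csubspace T" and "\<And>js. length js = n \<Longrightarrow> g js \<in> T"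
  shows "clinear_on S T (\<lambda>\<xi>. \<Sum>js | length js = n. \<xi> (map f js) *\<^sub>C g js)"
  using assms
  by (auto simp: clinear_on_def scaleC_add_left sum.distrib scaleC_fun_apply
      complex_vector.scale_sum_right scaleC_complex_def
      intro!: complex_vector.subspace_sum complex_vector.subspace_scale)

text \<open>The universal property. In the expansion of a symmetric multilinear map the tensor occurs only through
  its values at tuples from the dual basis, so the same formula, read as a function of an arbitrary
  tensor, is linear and extends \<open>g\<close>. No compatibility with linear relations between symmetric tensor
  products has to be checked.\<close>

lemma
  fixes g :: "'v list \<Rightarrow> 'w::complex_vector"
  assumes g: "multilinear n g" "symmetric n g"
  shows sym_lift_eq: "\<xi> \<in> sym_power n \<Longrightarrow>
      sym_lift n g \<xi> = (\<Sum>js | length js = n. \<xi> (map f js) *\<^sub>C g (map e js))"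
    and clinear_on_sym_lift: "clinear_on (sym_power n) UNIV (sym_lift n g)"
    and sym_lift_sym_tensor: "length vs = n \<Longrightarrow> sym_lift n g (sym_tensor vs) = g vs"
proof -
  define F where "F = restrict (\<lambda>\<xi>. \<Sum>js | length js = n. \<xi> (map f js) *\<^sub>C g (map e js)) (sym_power n)"
  have lin: "clinear_on (sym_power n) UNIV F"
    unfolding F_def by (intro clinear_on_restrict clinear_on_dual_expansion csubspace_sym_power) auto
  have val: "F (sym_tensor vs) = g vs" if "length vs = n" for vs
    using that symmetric_multilinear_expansion[OF g that]
    by (simp add: F_def sym_tensor_in_sym_power)
  have "sym_lift n g = F"
    unfolding sym_lift_def
  proof (rule the_equality)
    show "F \<in> extensional (sym_power n) \<and> clinear_on (sym_power n) UNIV F \<and>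
        (\<forall>vs. length vs = n \<longrightarrow> F (sym_tensor vs) = g vs)"
      using lin val by (simp add: F_def)
  next
    fix G
    assume G: "G \<in> extensional (sym_power n) \<and> clinear_on (sym_power n) UNIV G \<and>
        (\<forall>vs. length vs = n \<longrightarrow> G (sym_tensor vs) = g vs)"
    then have "G \<xi> = F \<xi>" if "\<xi> \<in> sym_power n" for \<xi>
      using sym_power_clinear_eq[of n UNIV G UNIV F \<xi>] lin val that by simp
    moreover have "F \<in> extensional (sym_power n)" by (simp add: F_def)
    ultimately show "G = F"
      using G by (intro extensionalityI[of G "sym_power n" F]) auto
  qed
  then show "\<xi> \<in> sym_power n \<Longrightarrow>
      sym_lift n g \<xi> = (\<Sum>js | length js = n. \<xi> (map f js) *\<^sub>C g (map e js))"
    and "clinear_on (sym_power n) UNIV (sym_lift n g)"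
    and "length vs = n \<Longrightarrow> sym_lift n g (sym_tensor vs) = g vs"
    using lin val by (simp_all add: F_def)
qed

lemma sym_power_expansion:
  assumes "\<xi> \<in> sym_power n"
  shows "\<xi> = (\<Sum>js | length js = n. \<xi> (map f js) *\<^sub>C sym_tensor (map e js))"
proof (rule sym_power_clinear_eq[OF _ _ _ assms])
  show "clinear_on (sym_power n) UNIV (\<lambda>\<xi>. \<xi>)"
    by (simp add: clinear_on_def)
  show "clinear_on (sym_power n) UNIV
      (\<lambda>\<xi>. \<Sum>js | length js = n. \<xi> (map f js) *\<^sub>C sym_tensor (map e js))"
    by (rule clinear_on_dual_expansion) auto
  show "sym_tensor vs = (\<Sum>js | length js = n. sym_tensor vs (map f js) *\<^sub>C sym_tensor (map e js))"
    if "length vs = n" for vs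
    using that by (rule symmetric_multilinear_expansion[OF multilinear_sym_tensor symmetric_sym_tensor])
qed

end

section \<open>Polarization\<close>

text \<open>Ryser's formula for the permanent. Expanding the product of the row sums over the columns in \<open>S\<close> gives
  a sum over all maps into \<open>S\<close>, which splits according to the image \<open>T\<close>; Moebius inversion over the
  subsets recovers the surjective maps, that is, the permutations.\<close>

lemma sum_permutations_prod_eq_alternating:
  fixes a :: "nat \<Rightarrow> nat \<Rightarrow> 'a::comm_ring_1"
  shows "(\<Sum>\<sigma> | \<sigma> permutes {..<n}. \<Prod>i<n. a i (\<sigma> i)) =
    (\<Sum>T\<in>Pow {..<n}. (-1) ^ (n - card T) * (\<Prod>i<n. \<Sum>k\<in>T. a i k))"
proof -
  define p where "p h = (\<Prod>i<n. a i (h i))" for h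
  \<comment> \<open>the maps are taken extensional, so that each one is counted once\<close>
  define F where "F T = sum p {h \<in> extensional {..<n}. h ` {..<n} = T}" for T
  have F: "(\<Prod>i<n. \<Sum>k\<in>S. a i k) = sum F (Pow S)" if S: "finite S" for S
  proof -
    have "(\<Prod>i<n. \<Sum>k\<in>S. a i k) = sum p ({..<n} \<rightarrow>\<^sub>E S)"
      unfolding p_def using S by (intro prod_sum_PiE) auto
    also have "\<dots> = (\<Sum>T\<in>Pow S. sum p {h \<in> {..<n} \<rightarrow>\<^sub>E S. h ` {..<n} = T})"
      using S by (intro sum.group[symmetric]) (auto intro: finite_PiE)
    also have "\<dots> = sum F (Pow S)"
      unfolding F_def
    proof (rule sum.cong[OF refl])
      fix T assume "T \<in> Pow S"
      then have "{h \<in> {..<n} \<rightarrow>\<^sub>E S. h ` {..<n} = T} = {h \<in> extensional {..<n}. h ` {..<n} = T}"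
        by (auto simp: PiE_def)
      then show "sum p {h \<in> {..<n} \<rightarrow>\<^sub>E S. h ` {..<n} = T} =
          sum p {h \<in> extensional {..<n}. h ` {..<n} = T}"
        by simp
    qed
    finally show ?thesis .
  qed
  have "(\<Sum>\<sigma> | \<sigma> permutes {..<n}. \<Prod>i<n. a i (\<sigma> i)) = F {..<n}"
    unfolding F_def
  proof (rule sum.reindex_bij_witness[where i = "\<lambda>h x. if x < n then h x else x"
        and j = "\<lambda>\<sigma>. restrict \<sigma> {..<n}"])
    fix \<sigma> assume "\<sigma> \<in> {\<sigma>. \<sigma> permutes {..<n}}"
    then have \<sigma>: "\<sigma> permutes {..<n}" by simp
    show "(\<lambda>x. if x < n then restrict \<sigma> {..<n} x else x) = \<sigma>"
      using permutes_not_in[OF \<sigma>] by (auto simp: fun_eq_iff)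
    show "restrict \<sigma> {..<n} \<in> {h \<in> extensional {..<n}. h ` {..<n} = {..<n}}"
      using permutes_image[OF \<sigma>] by simp
    show "p (restrict \<sigma> {..<n}) = (\<Prod>i<n. a i (\<sigma> i))"
      unfolding p_def by (intro prod.cong) auto
  next
    fix h assume "h \<in> {h \<in> extensional {..<n}. h ` {..<n} = {..<n}}"
    then have h: "h \<in> extensional {..<n}" "h ` {..<n} = {..<n}" by auto
    show "restrict (\<lambda>x. if x < n then h x else x) {..<n} = h"
      using h(1) by (auto simp: fun_eq_iff restrict_def extensional_def)
    have "inj_on h {..<n}"
      using h(2) by (intro eq_card_imp_inj_on) auto
    with h(2) have "bij_betw h {..<n} {..<n}" by (simp add: bij_betw_def)
    then have "bij_betw (\<lambda>x. if x < n then h x else x) {..<n} {..<n}"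
      by (subst bij_betw_cong[of _ _ h]) auto
    then show "(\<lambda>x. if x < n then h x else x) \<in> {\<sigma>. \<sigma> permutes {..<n}}"
      unfolding mem_Collect_eq by (rule bij_imp_permutes) simp
  qed
  also have "F {..<n} =
      (\<Sum>T\<in>Pow {..<n}. (-1) ^ (card {..<n} - card T) * (\<Prod>i<n. \<Sum>k\<in>T. a i k))"
    by (rule inclusion_exclusion_mobius[OF F]) auto
  finally show ?thesis by simp
qed

lemma tensor_replicate:
  "tensor (replicate n u) ws = (if length ws = n then \<Prod>i<n. cinner (ws ! i) u else 0)"
  by (auto simp: tensor_def intro!: prod.cong)

lemma sym_tensor_replicate: "sym_tensor (replicate n u) = tensor (replicate n u)"
proof
  fix ws
  have "permute_list \<sigma> (replicate n u) = replicate n u" if "\<sigma> permutes {..<n}" for \<sigma>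
    using that permutes_in_image[OF that]
    by (intro nth_equalityI) (simp_all add: permute_list_nth)
  then show "sym_tensor (replicate n u) ws = tensor (replicate n u) ws"
    by (simp add: sym_tensor_apply card_permutations)
qed

text \<open>Both sides are permanents of the matrix \<open>\<langle>w\<^sub>i, v\<^sub>k\<rangle>\<close>, up to the factor \<open>n!\<close>: the left one by
  definition, the right one by Ryser's formula.\<close>

lemma polarization:
  assumes n: "length vs = n"
  shows "sym_tensor vs = (\<Sum>T\<in>Pow {..<n}. ((-1) ^ (n - card T) / fact n) *\<^sub>C
      tensor (replicate n (\<Sum>k\<in>T. vs ! k)))"
proof
  fix ws
  let ?rhs = "\<Sum>T\<in>Pow {..<n}. ((-1) ^ (n - card T) / fact n) *\<^sub>C
      tensor (replicate n (\<Sum>k\<in>T. vs ! k))"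
  have rhs: "?rhs ws = 1 / fact n * (\<Sum>T\<in>Pow {..<n}. (-1) ^ (n - card T) *
      tensor (replicate n (\<Sum>k\<in>T. vs ! k)) ws)"
    by (simp add: sum_fun_apply scaleC_fun_apply scaleC_complex_def sum_distrib_left)
  show "sym_tensor vs ws = ?rhs ws"
  proof (cases "length ws = n")
    case False
    with n show ?thesis unfolding rhs by (simp add: sym_tensor_length tensor_replicate)
  next
    case True
    have "(\<Sum>\<sigma> | \<sigma> permutes {..<n}. tensor (permute_list \<sigma> vs) ws) =
        (\<Sum>\<sigma> | \<sigma> permutes {..<n}. \<Prod>i<n. cinner (ws ! i) (vs ! \<sigma> i))"
      using n True by (intro sum.cong) (auto simp: tensor_def permute_list_nth intro!: prod.cong)
    also have "\<dots> = (\<Sum>T\<in>Pow {..<n}. (-1) ^ (n - card T) *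
        tensor (replicate n (\<Sum>k\<in>T. vs ! k)) ws)"
      using True sum_permutations_prod_eq_alternating[of "\<lambda>i k. cinner (ws ! i) (vs ! k)" n]
      by (simp add: tensor_replicate clinear_sum[OF clinear_cinner])
    finally show ?thesis
      using n unfolding rhs by (simp add: sym_tensor_apply)
  qed
qed

lemma tensor_replicate_in_sym_power: "tensor (replicate n u) \<in> sym_power n"
  using sym_tensor_in_sym_power[of "replicate n u" n] by (simp add: sym_tensor_replicate)

lemma sym_power_eq_span_powers: "sym_power n = cspan (range (\<lambda>u. tensor (replicate n u)))"
proof
  show "cspan (range (\<lambda>u. tensor (replicate n u))) \<subseteq> sym_power n"
    by (rule complex_vector.span_minimal)
      (auto simp: tensor_replicate_in_sym_power csubspace_sym_power)
  have "sym_tensor vs \<in> cspan (range (\<lambda>u. tensor (replicate n u)))" if "length vs = n" for vs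
    unfolding polarization[OF that]
    by (intro complex_vector.span_sum complex_vector.span_scale complex_vector.span_base) auto
  then show "sym_power n \<subseteq> cspan (range (\<lambda>u. tensor (replicate n u)))"
    unfolding sym_power_def by (intro complex_vector.span_minimal) auto
qed

section \<open>The scalar product of the symmetric power\<close>

lemma sesquilinear_on_right:
  "sesquilinear_on S B \<Longrightarrow> \<xi> \<in> S \<Longrightarrow> clinear_on S UNIV (B \<xi>)"
  by (auto simp: sesquilinear_on_def clinear_on_def scaleC_complex_def)

lemma sesquilinear_on_left:
  "sesquilinear_on S B \<Longrightarrow> \<eta> \<in> S \<Longrightarrow> clinear_on S UNIV (\<lambda>\<xi>. cnj (B \<xi> \<eta>))"
  by (auto simp: sesquilinear_on_def clinear_on_def scaleC_complex_def)

text \<open>This is what makes the scalar product on the symmetric power unique: the powers span it.\<close>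

lemma sesquilinear_on_powers_eq:
  assumes B: "sesquilinear_on (sym_power n) B" and B': "sesquilinear_on (sym_power n) B'"
    and eq: "\<And>u v. B (tensor (replicate n u)) (tensor (replicate n v)) =
      B' (tensor (replicate n u)) (tensor (replicate n v))"
    and \<xi>: "\<xi> \<in> sym_power n" and \<eta>: "\<eta> \<in> sym_power n"
  shows "B \<xi> \<eta> = B' \<xi> \<eta>"
proof -
  let ?G = "range (\<lambda>u. tensor (replicate n u))"
  have 1: "B (tensor (replicate n u)) \<eta> = B' (tensor (replicate n u)) \<eta>" for u
    using clinear_on_span_eq[of ?G UNIV "B (tensor (replicate n u))" UNIV
        "B' (tensor (replicate n u))" \<eta>] eq \<eta>
      sesquilinear_on_right[OF B tensor_replicate_in_sym_power]
      sesquilinear_on_right[OF B' tensor_replicate_in_sym_power]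
    by (auto simp flip: sym_power_eq_span_powers)
  have "cnj (B \<xi> \<eta>) = cnj (B' \<xi> \<eta>)"
    using clinear_on_span_eq[of ?G UNIV "\<lambda>\<xi>. cnj (B \<xi> \<eta>)" UNIV "\<lambda>\<xi>. cnj (B' \<xi> \<eta>)" \<xi>] 1 \<xi>
      sesquilinear_on_left[OF B \<eta>] sesquilinear_on_left[OF B' \<eta>]
    by (auto simp flip: sym_power_eq_span_powers)
  then show ?thesis by simp
qed

context dual_pair
begin

text \<open>The conjugate of a tensor \<open>\<xi>\<close> is symmetric and multilinear, so it has a linear extension to the
  symmetric power; the value of that extension at \<open>\<eta>\<close> is \<open>\<langle>\<xi>, \<eta>\<rangle>\<close>. The second statement is the
  resulting reproducing property: scalar products with symmetric tensor products evaluate the form.\<close>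

lemma
  fixes \<xi> :: "'v tensor"
  shows sesquilinear_sym_inner: "sesquilinear_on (sym_power n) (sym_inner n :: 'v tensor \<Rightarrow> _)"
    and sym_inner_sym_tensor_right:
      "\<xi> \<in> sym_power n \<Longrightarrow> length vs = n \<Longrightarrow> sym_inner n \<xi> (sym_tensor vs) = cnj (\<xi> vs)"
proof -
  define B :: "'v tensor \<Rightarrow> 'v tensor \<Rightarrow> complex" where
    "B \<xi> \<eta> = (if \<xi> \<in> sym_power n \<and> \<eta> \<in> sym_power n
      then \<Sum>js | length js = n. \<eta> (map f js) *\<^sub>C cnj (\<xi> (map e js)) else 0)" for \<xi> \<eta>
  have sesq: "sesquilinear_on (sym_power n) B"
    by (auto simp: sesquilinear_on_def B_def scaleC_complex_def scaleC_fun_apply sum.distrib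
        sum_distrib_left algebra_simps complex_vector.subspace_add[OF csubspace_sym_power]
        complex_vector.subspace_scale[OF csubspace_sym_power])
  have val: "B \<xi> (sym_tensor vs) = cnj (\<xi> vs)" if "\<xi> \<in> sym_power n" "length vs = n" for \<xi> vs
  proof -
    have "symmetric n (\<lambda>ws. cnj (\<xi> ws))"
      using symmetric_sym_power[OF that(1)] by (simp add: symmetric_def)
    from symmetric_multilinear_expansion[OF multilinear_cnj_sym_power[OF that(1)] this that(2)] that
    show ?thesis by (simp add: B_def sym_tensor_in_sym_power)
  qed
  have pow: "B (tensor (replicate n u)) (tensor (replicate n v)) = cinner u v ^ n" for u v
    using val[OF tensor_replicate_in_sym_power, of "replicate n v" u] cinner_commute[of u v]
    by (simp add: sym_tensor_replicate tensor_hermitian tensor_replicate)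
  have zero: "B \<xi> \<eta> = 0" if "\<xi> \<notin> sym_power n \<or> \<eta> \<notin> sym_power n" for \<xi> \<eta>
    using that unfolding B_def by (intro if_not_P) blast
  have "sym_inner n = B"
    unfolding sym_inner_def
  proof (rule the_equality)
    show "(\<forall>\<xi> \<eta>. \<xi> \<notin> sym_power n \<or> \<eta> \<notin> sym_power n \<longrightarrow> B \<xi> \<eta> = 0) \<and>
        sesquilinear_on (sym_power n) B \<and>
        (\<forall>u v. B (tensor (replicate n u)) (tensor (replicate n v)) = cinner u v ^ n)"
      using zero sesq pow by blast
  next
    fix B' :: "'v tensor \<Rightarrow> 'v tensor \<Rightarrow> complex"
    assume B': "(\<forall>\<xi> \<eta>. \<xi> \<notin> sym_power n \<or> \<eta> \<notin> sym_power n \<longrightarrow> B' \<xi> \<eta> = 0) \<and>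
        sesquilinear_on (sym_power n) B' \<and>
        (\<forall>u v. B' (tensor (replicate n u)) (tensor (replicate n v)) = cinner u v ^ n)"
    show "B' = B"
    proof (intro ext)
      fix \<xi> \<eta>
      show "B' \<xi> \<eta> = B \<xi> \<eta>"
      proof (cases "\<xi> \<in> sym_power n \<and> \<eta> \<in> sym_power n")
        case True
        have "B' (tensor (replicate n u)) (tensor (replicate n v)) =
            B (tensor (replicate n u)) (tensor (replicate n v))" for u v
          using B' pow by metis
        moreover have "sesquilinear_on (sym_power n) B'" using B' by blast
        ultimately show ?thesis
          using True sesq sesquilinear_on_powers_eq[of n B' B \<xi> \<eta>] by blast
      next
        case False
        then have "B' \<xi> \<eta> = 0" "B \<xi> \<eta> = 0"
          using B' zero by blast+
        then show ?thesis by simp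
      qed
    qed
  qed
  then show "sesquilinear_on (sym_power n) (sym_inner n :: 'v tensor \<Rightarrow> _)"
    and "\<xi> \<in> sym_power n \<Longrightarrow> length vs = n \<Longrightarrow> sym_inner n \<xi> (sym_tensor vs) = cnj (\<xi> vs)"
    using sesq val by auto
qed

lemma sym_inner_sym_tensor_left:
  fixes \<eta> :: "'v tensor"
  assumes "\<eta> \<in> sym_power n" "length vs = n"
  shows "sym_inner n (sym_tensor vs) \<eta> = \<eta> vs"
proof (rule sym_power_clinear_eq[OF _ _ _ assms(1)])
  show "clinear_on (sym_power n) UNIV (sym_inner n (sym_tensor vs))"
    by (rule sesquilinear_on_right[OF sesquilinear_sym_inner sym_tensor_in_sym_power[OF assms(2)]])
  show "clinear_on (sym_power n) UNIV (\<lambda>\<eta>. \<eta> vs)"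
    by (simp add: clinear_on_def scaleC_fun_apply)
  show "sym_inner n (sym_tensor vs) (sym_tensor ws) = sym_tensor ws vs" if "length ws = n" for ws
    using that assms(2)
    by (simp add: sym_inner_sym_tensor_right sym_tensor_in_sym_power sym_tensor_hermitian)
qed

text \<open>A form is determined by its values, and these are scalar products.\<close>

lemma sym_inner_nondegenerate:
  fixes \<eta> \<eta>' :: "'v tensor"
  assumes \<eta>: "\<eta> \<in> sym_power n" "\<eta>' \<in> sym_power n"
    and eq: "\<And>\<xi>. \<xi> \<in> sym_power n \<Longrightarrow> sym_inner n \<xi> \<eta> = sym_inner n \<xi> \<eta>'"
  shows "\<eta> = \<eta>'"
proof
  fix vs
  show "\<eta> vs = \<eta>' vs"
  proof (cases "length vs = n")
    case True
    then show ?thesis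
      using eq[OF sym_tensor_in_sym_power[OF True]] \<eta> by (simp add: sym_inner_sym_tensor_left)
  next
    case False
    then show ?thesis using \<eta> by (simp add: sym_power_length)
  qed
qed

text \<open>The Riesz representation with an explicit operator, in place of an orthonormal basis: the values
  \<open>Q (e\<^sub>j \<otimes> \<dots>) \<eta>\<close> become coefficients of the tensors of the dual basis. It yields the
  operators \<open>\<Omega>\<close> as well as adjoints.\<close>

lemma ex1_operator_of_sesquilinear:
  assumes Q: "sesquilinear_on (sym_power n) (Q :: 'v tensor \<Rightarrow> _)"
  shows "\<exists>!T. T \<in> extensional (sym_power n) \<and> clinear_on (sym_power n) (sym_power n) T \<and>
    (\<forall>\<xi>\<in>sym_power n. \<forall>\<eta>\<in>sym_power n. sym_inner n \<xi> (T \<eta>) = Q \<xi> \<eta>)"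
proof (rule ex_ex1I)
  \<comment> \<open>\<open>\<langle>\<xi>, T \<eta>\<rangle>\<close> then expands to \<open>Q\<close> applied to the expansion of \<open>\<xi>\<close> in the tensors of the \<open>e\<^sub>j\<close>\<close>
  define T where "T = restrict (\<lambda>\<eta>. \<Sum>js | length js = n.
      Q (sym_tensor (map e js)) \<eta> *\<^sub>C sym_tensor (map f js)) (sym_power n)"
  have mem: "sym_tensor (map h js) \<in> sym_power n" if "length js = n" for h :: "'d \<Rightarrow> 'v" and js
    using that by (simp add: sym_tensor_in_sym_power)
  have "clinear_on (sym_power n) (sym_power n) T"
    unfolding T_def
  proof (intro clinear_on_restrict csubspace_sym_power)
    have "clinear_on (sym_power n) UNIV (Q (sym_tensor (map e js)))" if "length js = n" for js
      using sesquilinear_on_right[OF Q mem[OF that]] .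
    then show "clinear_on (sym_power n) (sym_power n) (\<lambda>\<eta>. \<Sum>js | length js = n.
        Q (sym_tensor (map e js)) \<eta> *\<^sub>C sym_tensor (map f js))"
      using mem by (auto simp: clinear_on_def scaleC_add_left sum.distrib scaleC_complex_def
          complex_vector.scale_sum_right intro!: sum_in_sym_power)
  qed
  moreover have "sym_inner n \<xi> (T \<eta>) = Q \<xi> \<eta>"
    if \<xi>: "\<xi> \<in> sym_power n" and \<eta>: "\<eta> \<in> sym_power n" for \<xi> \<eta>
  proof -
    have "sym_inner n \<xi> (T \<eta>) =
        (\<Sum>js | length js = n.
          Q (sym_tensor (map e js)) \<eta> *\<^sub>C sym_inner n \<xi> (sym_tensor (map f js)))"
      unfolding T_def restrict_apply'[OF \<eta>]
      by (rule clinear_on_sum[OF sesquilinear_on_right[OF sesquilinear_sym_inner \<xi>] csubspace_sym_power])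
        (simp add: mem)
    also have "\<dots> = (\<Sum>js | length js = n. Q (sym_tensor (map e js)) \<eta> *\<^sub>C cnj (\<xi> (map f js)))"
      using \<xi> by (simp add: sym_inner_sym_tensor_right)
    also have "\<dots> = cnj (\<Sum>js | length js = n. \<xi> (map f js) *\<^sub>C cnj (Q (sym_tensor (map e js)) \<eta>))"
      by (simp add: scaleC_complex_def mult.commute)
    also have "\<dots> = cnj (cnj (Q (\<Sum>js | length js = n. \<xi> (map f js) *\<^sub>C sym_tensor (map e js)) \<eta>))"
      using mem by (subst clinear_on_sum[OF sesquilinear_on_left[OF Q \<eta>] csubspace_sym_power]) auto
    finally show ?thesis
      using sym_power_expansion[OF \<xi>] by simp
  qed
  ultimately show "\<exists>T. T \<in> extensional (sym_power n) \<and> clinear_on (sym_power n) (sym_power n) T \<and>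
      (\<forall>\<xi>\<in>sym_power n. \<forall>\<eta>\<in>sym_power n. sym_inner n \<xi> (T \<eta>) = Q \<xi> \<eta>)"
    by (intro exI[of _ T]) (simp add: T_def)
next
  fix T T' :: "'v tensor \<Rightarrow> 'v tensor"
  assume T: "T \<in> extensional (sym_power n) \<and> clinear_on (sym_power n) (sym_power n) T \<and>
      (\<forall>\<xi>\<in>sym_power n. \<forall>\<eta>\<in>sym_power n. sym_inner n \<xi> (T \<eta>) = Q \<xi> \<eta>)"
    and T': "T' \<in> extensional (sym_power n) \<and> clinear_on (sym_power n) (sym_power n) T' \<and>
      (\<forall>\<xi>\<in>sym_power n. \<forall>\<eta>\<in>sym_power n. sym_inner n \<xi> (T' \<eta>) = Q \<xi> \<eta>)"
  show "T = T'"
  proof (rule extensionalityI[of T "sym_power n" T'])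
    show "T \<in> extensional (sym_power n)" "T' \<in> extensional (sym_power n)"
      using T T' by auto
  next
    fix \<eta> :: "'v tensor" assume \<eta>: "\<eta> \<in> sym_power n"
    then have "T \<eta> \<in> sym_power n" "T' \<eta> \<in> sym_power n"
      using T T' clinear_on_imp_mem by blast+
    then show "T \<eta> = T' \<eta>"
      using T T' \<eta> by (intro sym_inner_nondegenerate[of "T \<eta>" n "T' \<eta>"]) auto
  qed
qed

end

section \<open>The degree filtration\<close>

lemma scaleC_poly_eq: "c *\<^sub>C p = Poly_Mapping.single 0 c * p" for p :: "'d cpoly"
proof -
  have "(scaleC c :: complex \<Rightarrow> complex) = (*) c"
    by (simp add: fun_eq_iff scaleC_complex_def)
  then have "c *\<^sub>C p = Poly_Mapping.map ((*) c) p"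
    by (simp add: scaleC_poly_mapping_def)
  then show ?thesis by (simp add: mult_map_scale_conv_mult)
qed

lemma clinear_poly_mult: "clinear (\<lambda>p. q * p)" for q :: "'d cpoly"
  by (intro clinearI) (simp_all add: distrib_left scaleC_poly_eq mult.left_commute)

lemma indet_mult_monomial: "indet j * monomial m = monomial (Poly_Mapping.single j 1 + m)"
  by (simp add: indet_def monomial_def mult_single)

lemma monomial_degree_add: "monomial_degree (m + m') = monomial_degree m + monomial_degree m'"
  by (simp add: monomial_degree_def lookup_add sum.distrib)

lemma monomial_degree_single: "monomial_degree (Poly_Mapping.single j 1) = 1"
  by (simp add: monomial_degree_def lookup_single when_def)

lemma csubspace_poly_upto: "csubspace (poly_upto k)"
  by (simp add: poly_upto_def)

lemma poly_upto_mono: "k \<le> l \<Longrightarrow> poly_upto k \<subseteq> poly_upto l"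
  unfolding poly_upto_def by (rule complex_vector.span_mono) auto

lemma poly_upto_neg: "k < 0 \<Longrightarrow> poly_upto k = {0}"
  by (simp add: poly_upto_def)

lemma monomial_in_poly_upto: "int (monomial_degree m) \<le> k \<Longrightarrow> monomial m \<in> poly_upto k"
  unfolding poly_upto_def by (intro complex_vector.span_base) auto

lemma indet_mult_poly_upto:
  assumes "p \<in> poly_upto k"
  shows "indet j * p \<in> poly_upto (k + 1)"
  using assms unfolding poly_upto_def[of k]
proof (induction rule: complex_vector.span_induct_alt)
  case base
  then show ?case by (simp add: complex_vector.subspace_0 csubspace_poly_upto)
next
  case (step c x y)
  then obtain m where m: "x = monomial m" "int (monomial_degree m) \<le> k" by blast
  have "indet j * x \<in> poly_upto (k + 1)"
    using m(2) unfolding m(1) indet_mult_monomial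
    by (intro monomial_in_poly_upto) (simp add: monomial_degree_add monomial_degree_single del: One_nat_def)
  with step show ?case
    by (simp add: clinear_add[OF clinear_poly_mult] clinear_scaleC[OF clinear_poly_mult]
        complex_vector.subspace_add complex_vector.subspace_scale csubspace_poly_upto)
qed

lemma lookup_poly_upto:
  assumes "p \<in> poly_upto k" "k < int (monomial_degree m)"
  shows "Poly_Mapping.lookup p m = 0"
  using assms(1) unfolding poly_upto_def
proof (induction rule: complex_vector.span_induct_alt)
  case (step c x y)
  then obtain m' where "x = monomial m'" "int (monomial_degree m') \<le> k" by blast
  with assms(2) step show ?case
    by (auto simp: lookup_add monomial_def lookup_single when_def scaleC_complex_def)
qed simp

lemma lookup_monomial: "Poly_Mapping.lookup (monomial m) m' = (if m = m' then 1 else 0)"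
  by (simp add: monomial_def lookup_single when_def)

definition exponents :: "'d list \<Rightarrow> ('d \<Rightarrow>\<^sub>0 nat)" where
  "exponents js = (\<Sum>j\<leftarrow>js. Poly_Mapping.single j 1)"

lemma exponents_Nil: "exponents [] = 0"
  and exponents_Cons: "exponents (j # js) = Poly_Mapping.single j 1 + exponents js"
  by (simp_all add: exponents_def)

lemma lookup_exponents: "Poly_Mapping.lookup (exponents js) j = count (mset js) j"
  by (induction js) (simp_all add: exponents_Nil exponents_Cons lookup_add lookup_single when_def)

lemma monomial_degree_exponents: "monomial_degree (exponents js) = length js"
proof (induction js)
  case Nil
  then show ?case by (simp add: exponents_Nil monomial_degree_def)
next
  case (Cons j js)
  then show ?case
    unfolding exponents_Cons monomial_degree_add by (simp add: monomial_degree_single del: One_nat_def)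
qed

lemma exponents_eq_iff: "exponents js = exponents ks \<longleftrightarrow> mset js = mset ks"
proof
  assume "exponents js = exponents ks"
  then show "mset js = mset ks"
    by (intro multiset_eqI) (simp flip: lookup_exponents)
next
  assume "mset js = mset ks"
  then show "exponents js = exponents ks"
    by (intro poly_mapping_eqI) (simp add: lookup_exponents)
qed

lemma ex_exponents:
  fixes m :: "'d::finite \<Rightarrow>\<^sub>0 nat"
  obtains js where "exponents js = m" "length js = monomial_degree m"
proof -
  obtain js where js: "mset js = Abs_multiset (Poly_Mapping.lookup m)"
    using ex_mset by blast
  have "exponents js = m"
    by (intro poly_mapping_eqI) (simp add: lookup_exponents js count_Abs_multiset)
  then show thesis
    using that[of js] monomial_degree_exponents[of js] by simp
qed

section \<open>Projections and creation operators\<close>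

text \<open>The decomposition refines the degree filtration: \<open>P n\<close> is a complement of the polynomials of
  degree below \<open>n\<close> among those of degree at most \<open>n\<close>. Consequently the projector \<open>P\<^sub>n\<close>
  kills everything of lower degree and alters a polynomial of degree at most \<open>n\<close> only by terms of lower
  degree, and these two facts control the creation operators.\<close>

locale graded_polynomials =
  fixes P :: "nat \<Rightarrow> 'd::finite cpoly set"
  assumes direct_sum: "is_direct_sum UNIV UNIV P"
    and direct_sum_upto: "is_direct_sum (poly_upto (int n)) {..n} P"
begin

lemma csubspace_P: "csubspace (P n)"
  using direct_sum by (simp add: is_direct_sum_def)

lemma P_subset_poly_upto: "P n \<subseteq> poly_upto (int n)"
  using direct_sum_upto[of n] by (simp add: is_direct_sum_def)

lemma is_decomp_decomp_proj: "is_decomp UNIV P p (\<lambda>n. decomp_proj P n p)"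
proof -
  have "\<exists>!c. is_decomp UNIV P p c"
    using direct_sum by (simp add: is_direct_sum_def)
  then show ?thesis
    unfolding decomp_proj_def by (rule theI')
qed

lemma decomp_proj_eqI:
  assumes "\<And>i. c i \<in> P i" "finite A" "\<And>i. i \<notin> A \<Longrightarrow> c i = 0" "p = sum c A"
  shows "decomp_proj P n p = c n"
proof -
  have sub: "{i. c i \<noteq> 0} \<subseteq> A" using assms(3) by blast
  have "is_decomp UNIV P p c"
    unfolding is_decomp_def
    using assms(1,4) finite_subset[OF sub assms(2)] sum.mono_neutral_left[OF assms(2) sub, of c]
    by auto
  moreover have "\<exists>!c. is_decomp UNIV P p c"
    using direct_sum by (simp add: is_direct_sum_def)
  ultimately have "(\<lambda>n. decomp_proj P n p) = c"
    using is_decomp_decomp_proj[of p] by blast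
  then show ?thesis by (simp add: fun_eq_iff)
qed

lemma decomp_proj_mem: "decomp_proj P n p \<in> P n"
  using is_decomp_decomp_proj[of p] by (simp add: is_decomp_def)

lemma finite_support: "finite {n. decomp_proj P n p \<noteq> 0}"
  using is_decomp_decomp_proj[of p] by (simp add: is_decomp_def)

lemma sum_decomp_proj:
  assumes "finite A" "{n. decomp_proj P n p \<noteq> 0} \<subseteq> A"
  shows "p = (\<Sum>n\<in>A. decomp_proj P n p)"
proof -
  have "p = (\<Sum>n | decomp_proj P n p \<noteq> 0. decomp_proj P n p)"
    using is_decomp_decomp_proj[of p] by (simp add: is_decomp_def)
  also have "\<dots> = (\<Sum>n\<in>A. decomp_proj P n p)"
    using assms by (intro sum.mono_neutral_left) auto
  finally show ?thesis .
qed

lemma clinear_decomp_proj: "clinear (decomp_proj P n)"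
proof (rule clinearI)
  fix p q :: "'d cpoly" and c
  let ?A = "{n. decomp_proj P n p \<noteq> 0} \<union> {n. decomp_proj P n q \<noteq> 0}"
  have "finite ?A" by (simp add: finite_support)
  then have "p + q = (\<Sum>n\<in>?A. decomp_proj P n p + decomp_proj P n q)"
    using sum_decomp_proj[of ?A p] sum_decomp_proj[of ?A q] by (simp add: sum.distrib)
  with \<open>finite ?A\<close> show "decomp_proj P n (p + q) = decomp_proj P n p + decomp_proj P n q"
    by (intro decomp_proj_eqI[of _ ?A])
      (auto intro: complex_vector.subspace_add csubspace_P decomp_proj_mem)
  let ?B = "{n. decomp_proj P n p \<noteq> 0}"
  have "c *\<^sub>C p = (\<Sum>n\<in>?B. c *\<^sub>C decomp_proj P n p)"
    using sum_decomp_proj[OF finite_support[of p] order_refl]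
    by (metis complex_vector.scale_sum_right)
  then show "decomp_proj P n (c *\<^sub>C p) = c *\<^sub>C decomp_proj P n p"
    by (intro decomp_proj_eqI[of _ ?B])
      (auto intro: complex_vector.subspace_scale csubspace_P decomp_proj_mem finite_support)
qed

lemma decomp_proj_P:
  assumes "p \<in> P n"
  shows "decomp_proj P m p = (if m = n then p else 0)"
  using assms by (intro decomp_proj_eqI[of _ "{n}"]) (auto intro: complex_vector.subspace_0 csubspace_P)

lemma decomp_proj_poly_upto:
  assumes "p \<in> poly_upto (int n)" "n < m"
  shows "decomp_proj P m p = 0"
proof -
  obtain c where c: "is_decomp {..n} P p c"
    using direct_sum_upto[of n] assms(1) by (auto simp: is_direct_sum_def)
  have out: "c i = 0" if "\<not> i \<le> n" for i
    using c that by (simp add: is_decomp_def)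
  have "decomp_proj P m p = c m"
  proof (rule decomp_proj_eqI[where A = "{i. c i \<noteq> 0}"])
    show "c i \<in> P i" for i
    proof (cases "i \<le> n")
      case True
      with c show ?thesis by (simp add: is_decomp_def)
    next
      case False
      with out show ?thesis by (simp add: complex_vector.subspace_0 csubspace_P)
    qed
  qed (use c in \<open>auto simp: is_decomp_def\<close>)
  with assms(2) out show ?thesis by simp
qed

lemma decomp_proj_lower:
  assumes "p \<in> poly_upto (int n - 1)"
  shows "decomp_proj P n p = 0"
proof (cases n)
  case 0
  with assms show ?thesis by (simp add: poly_upto_neg clinear_zero[OF clinear_decomp_proj])
next
  case (Suc k)
  with assms show ?thesis by (intro decomp_proj_poly_upto[of p k]) auto
qed

lemma decomp_proj_congruent:
  assumes p: "p \<in> poly_upto (int n)"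
  shows "p - decomp_proj P n p \<in> poly_upto (int n - 1)"
proof -
  have "p = (\<Sum>i\<le>n. decomp_proj P i p)"
    using decomp_proj_poly_upto[OF p] by (intro sum_decomp_proj) (auto simp: not_less[symmetric])
  then have "p - decomp_proj P n p = (\<Sum>i<n. decomp_proj P i p)"
    by (metis lessThan_Suc_atMost sum.lessThan_Suc add_diff_cancel_right')
  also have "\<dots> \<in> poly_upto (int n - 1)"
  proof (intro complex_vector.subspace_sum csubspace_poly_upto)
    fix i assume "i \<in> {..<n}"
    then have "poly_upto (int i) \<subseteq> poly_upto (int n - 1)"
      by (intro poly_upto_mono) auto
    then show "decomp_proj P i p \<in> poly_upto (int n - 1)"
      using decomp_proj_mem[of i p] P_subset_poly_upto[of i] by blast
  qed
  finally show ?thesis .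
qed

lemma decomp_proj_cong:
  assumes "p - q \<in> poly_upto (int n - 1)"
  shows "decomp_proj P n p = decomp_proj P n q"
  using decomp_proj_lower[OF assms] by (simp add: clinear_diff[OF clinear_decomp_proj])

lemma one_in_P: "1 \<in> P 0"
proof -
  have "monomial 0 = (1 :: 'd cpoly)" by (simp add: monomial_def)
  then have "(1 :: 'd cpoly) \<in> poly_upto (int 0)"
    using monomial_in_poly_upto[of "0 :: 'd \<Rightarrow>\<^sub>0 nat" 0] by (simp add: monomial_degree_def)
  from decomp_proj_congruent[OF this] have "decomp_proj P 0 1 = 1"
    by (simp add: poly_upto_neg)
  then show ?thesis using decomp_proj_mem[of 0 1] by simp
qed

lemma a_plus_eq_sum:
  assumes "finite A" "{n. decomp_proj P n p \<noteq> 0} \<subseteq> A"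
  shows "a_plus P j p = (\<Sum>n\<in>A. decomp_proj P (Suc n) (indet j * decomp_proj P n p))"
  unfolding a_plus_def a_plus_n_def
  using assms
  by (intro sum.mono_neutral_left) (auto simp: clinear_zero[OF clinear_decomp_proj])

lemma clinear_a_plus: "clinear (a_plus P j)"
proof (rule clinearI)
  fix p q :: "'d cpoly" and c
  let ?A = "{n. decomp_proj P n p \<noteq> 0} \<union> {n. decomp_proj P n q \<noteq> 0}"
  have A: "finite ?A" "{n. decomp_proj P n (p + q) \<noteq> 0} \<subseteq> ?A"
    by (auto simp: finite_support clinear_add[OF clinear_decomp_proj])
  then show "a_plus P j (p + q) = a_plus P j p + a_plus P j q"
    using a_plus_eq_sum[of ?A p] a_plus_eq_sum[of ?A q] a_plus_eq_sum[OF A]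
    by (simp add: sum.distrib clinear_add[OF clinear_decomp_proj] distrib_left)
  let ?B = "{n. decomp_proj P n p \<noteq> 0}"
  have B: "{n. decomp_proj P n (c *\<^sub>C p) \<noteq> 0} \<subseteq> ?B"
    by (auto simp: clinear_scaleC[OF clinear_decomp_proj])
  show "a_plus P j (c *\<^sub>C p) = c *\<^sub>C a_plus P j p"
    using a_plus_eq_sum[OF finite_support[of p] order_refl] a_plus_eq_sum[OF finite_support[of p] B]
    by (simp add: clinear_scaleC[OF clinear_decomp_proj] clinear_scaleC[OF clinear_poly_mult]
        complex_vector.scale_sum_right)
qed

lemma a_plus_P:
  assumes "p \<in> P n"
  shows "a_plus P j p = decomp_proj P (Suc n) (indet j * p)"
proof -
  have "{m. decomp_proj P m p \<noteq> 0} \<subseteq> {n}"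
    by (auto simp: decomp_proj_P[OF assms] split: if_splits)
  then show ?thesis
    using a_plus_eq_sum[of "{n}" p j] by (simp add: decomp_proj_P[OF assms])
qed

lemma a_plus_mem: "p \<in> P n \<Longrightarrow> a_plus P j p \<in> P (Suc n)"
  by (simp add: a_plus_P decomp_proj_mem)

lemma a_plus_congruent:
  assumes "p \<in> P n"
  shows "indet j * p - a_plus P j p \<in> poly_upto (int n)"
proof -
  have "indet j * p \<in> poly_upto (int (Suc n))"
    using assms P_subset_poly_upto[of n] indet_mult_poly_upto[of p "int n" j] by (auto simp: add.commute)
  from decomp_proj_congruent[OF this] show ?thesis
    by (simp add: a_plus_P[OF assms])
qed

text \<open>On \<open>P n\<close> both sides are the top component of \<open>X\<^sub>i X\<^sub>j p\<close>, since the lower-order error made by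
  the first projection still has too low a degree after one more multiplication.\<close>

lemma a_plus_commute: "a_plus P i (a_plus P j p) = a_plus P j (a_plus P i p)"
proof -
  have twice: "a_plus P i (a_plus P j q) = decomp_proj P (Suc (Suc n)) (indet i * (indet j * q))"
    if q: "q \<in> P n" for q n i j
    unfolding a_plus_P[OF a_plus_mem[OF q]]
  proof (rule decomp_proj_cong[symmetric])
    show "indet i * (indet j * q) - indet i * a_plus P j q \<in> poly_upto (int (Suc (Suc n)) - 1)"
      using indet_mult_poly_upto[OF a_plus_congruent[OF q, of j], of i]
      by (simp add: right_diff_distrib add.commute)
  qed
  have hom: "a_plus P i (a_plus P j q) = a_plus P j (a_plus P i q)" if "q \<in> P n" for q n
    unfolding twice[OF that] by (simp add: mult.left_commute)
  let ?S = "{n. decomp_proj P n p \<noteq> 0}"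
  have "a_plus P i (a_plus P j (\<Sum>n\<in>?S. decomp_proj P n p)) =
      a_plus P j (a_plus P i (\<Sum>n\<in>?S. decomp_proj P n p))"
    using hom[OF decomp_proj_mem] by (simp add: clinear_sum[OF clinear_a_plus])
  then show ?thesis
    by (simp flip: sum_decomp_proj[OF finite_support order_refl])
qed

lemma foldr_a_plus_mem: "foldr (a_plus P) js 1 \<in> P (length js)"
  by (induction js) (simp_all add: one_in_P a_plus_mem)

text \<open>One creation operator differs from multiplication by \<open>X\<^sub>j\<close> by terms of lower degree, and a
  further multiplication raises the degree of the error made so far by at most one.\<close>

lemma foldr_a_plus_congruent:
  "monomial (exponents js) - foldr (a_plus P) js 1 \<in> poly_upto (int (length js) - 1)"
proof (induction js)
  case Nil
  then show ?case by (simp add: exponents_Nil monomial_def complex_vector.subspace_0 csubspace_poly_upto)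
next
  case (Cons j js)
  let ?q = "foldr (a_plus P) js 1"
  have "indet j * (monomial (exponents js) - ?q) + (indet j * ?q - a_plus P j ?q)
      \<in> poly_upto (int (length js))"
    using indet_mult_poly_upto[OF Cons, of j] a_plus_congruent[OF foldr_a_plus_mem, of j js]
    by (intro complex_vector.subspace_add[OF csubspace_poly_upto]) auto
  then show ?case
    by (simp add: exponents_Cons right_diff_distrib flip: indet_mult_monomial[unfolded One_nat_def])
qed

section \<open>The isomorphism with the symmetric power\<close>

lemma clinear_a_plus_vec: "clinear (a_plus_vec P e v)"
  unfolding a_plus_vec_def by (intro clinear_sumI clinear_a_plus)

lemma clinear_a_plus_vec_arg: "is_basis e \<Longrightarrow> clinear (\<lambda>v. a_plus_vec P e v p)"
  unfolding a_plus_vec_def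
  by (intro clinearI)
    (simp_all add: clinear_add[OF coord_clinear] clinear_scaleC[OF coord_clinear] scaleC_add_left
      sum.distrib complex_vector.scale_sum_right scaleC_complex_def)

lemma a_plus_vec_basis: "is_basis e \<Longrightarrow> a_plus_vec P e (e i) = a_plus P i"
  by (simp add: fun_eq_iff a_plus_vec_def coord_basis
      if_distrib[where f = "\<lambda>c. c *\<^sub>C _"] cong: if_cong)

lemma a_plus_vec_commute:
  "a_plus_vec P e v (a_plus_vec P e w p) = a_plus_vec P e w (a_plus_vec P e v p)"
proof -
  have "a_plus_vec P e v (a_plus_vec P e w p) =
      (\<Sum>i\<in>UNIV. \<Sum>j\<in>UNIV. (coord e v i * coord e w j) *\<^sub>C a_plus P i (a_plus P j p))" for v w
    by (simp add: a_plus_vec_def clinear_sum[OF clinear_a_plus] clinear_scaleC[OF clinear_a_plus]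
        complex_vector.scale_sum_right)
  from this[of v w] this[of w v] show ?thesis
    by (subst (asm) (2) sum.swap) (simp add: mult.commute a_plus_commute)
qed

lemma multilinear_foldr_a_plus_vec:
  assumes "is_basis e"
  shows "multilinear n (\<lambda>vs. foldr (a_plus_vec P e) vs 1)"
proof -
  have "clinear (foldr (a_plus_vec P e) xs)" for xs
    by (induction xs) (auto simp: clinear_iff clinear_add[OF clinear_a_plus_vec]
        clinear_scaleC[OF clinear_a_plus_vec])
  then have "clinear (\<lambda>v. foldr (a_plus_vec P e) xs (a_plus_vec P e v (foldr (a_plus_vec P e) ys 1)))"
    for xs ys
    by (rule clinear_compose[OF _ clinear_a_plus_vec_arg[OF assms]])
  then show ?thesis
    by (simp add: multilinear_def)
qed

lemma symmetric_foldr_a_plus_vec: "symmetric n (\<lambda>vs. foldr (a_plus_vec P e) vs 1)"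
  unfolding symmetric_def foldr_conv_fold
proof (intro allI impI)
  fix vs ws :: "'a list"
  assume "mset vs = mset ws"
  then show "fold (a_plus_vec P e) (rev vs) 1 = fold (a_plus_vec P e) (rev ws) 1"
    by (intro fold_permuted_eq[where P = "\<lambda>_. True"]) (simp_all add: a_plus_vec_commute)
qed

text \<open>Bijectivity rests on leading terms. The coefficient of a monomial of degree \<open>n\<close> in \<open>U \<zeta>\<close> is a
  positive multiple of a coordinate of \<open>\<zeta>\<close>, because all tuples with the same exponents give the same
  coordinate; this gives injectivity. Conversely \<open>P n\<close> is spanned by the projections of the
  monomials of degree \<open>n\<close>, and those are the images of the symmetric tensor products of basis vectors.\<close>

lemma
  fixes e :: "'d \<Rightarrow> 'v::complex_inner"
  assumes e: "is_basis e"
  shows clinear_on_jacobi_U: "clinear_on (sym_power n) UNIV (jacobi_U P n e)"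
    and jacobi_U_sym_tensor:
      "length vs = n \<Longrightarrow> jacobi_U P n e (sym_tensor vs) = foldr (a_plus_vec P e) vs 1"
    and bij_betw_jacobi_U: "bij_betw (jacobi_U P n e) (sym_power n) (P n)"
proof -
  obtain f where f: "dual_pair e f" using ex_dual_pair[OF e] .
  interpret dual_pair e f by (rule f)
  note g = multilinear_foldr_a_plus_vec[OF e, of n] symmetric_foldr_a_plus_vec[of n e]
  show lin: "clinear_on (sym_power n) UNIV (jacobi_U P n e)"
    unfolding jacobi_U_def by (rule clinear_on_sym_lift[OF g])
  show val: "jacobi_U P n e (sym_tensor vs) = foldr (a_plus_vec P e) vs 1" if "length vs = n" for vs
    unfolding jacobi_U_def by (rule sym_lift_sym_tensor[OF g that])
  have foldr_basis: "foldr (a_plus_vec P e) (map e js) 1 = foldr (a_plus P) js 1" for js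
    by (simp add: foldr_map comp_def a_plus_vec_basis[OF e])
  have formula: "jacobi_U P n e \<xi> =
      (\<Sum>js | length js = n. \<xi> (map f js) *\<^sub>C foldr (a_plus P) js 1)" if "\<xi> \<in> sym_power n" for \<xi>
    unfolding jacobi_U_def by (subst sym_lift_eq[OF g that]) (simp add: foldr_basis)
  have inj0: "\<zeta> = 0" if \<zeta>: "\<zeta> \<in> sym_power n" and U0: "jacobi_U P n e \<zeta> = 0" for \<zeta>
  proof -
    let ?p = "\<Sum>js | length js = n. \<zeta> (map f js) *\<^sub>C monomial (exponents js)"
    have "?p = (\<Sum>js | length js = n. \<zeta> (map f js) *\<^sub>C (monomial (exponents js) - foldr (a_plus P) js 1))"
      using U0 formula[OF \<zeta>] by (simp add: complex_vector.scale_right_diff_distrib sum_subtractf)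
    also have "\<dots> \<in> poly_upto (int n - 1)"
      using foldr_a_plus_congruent
      by (intro complex_vector.subspace_sum complex_vector.subspace_scale csubspace_poly_upto) auto
    finally have low: "?p \<in> poly_upto (int n - 1)" .
    have "\<zeta> (map f ks) = 0" if ks: "length ks = n" for ks
    proof -
      let ?C = "{js. length js = n \<and> mset js = mset ks}"
      have fin: "finite ?C"
        by (rule finite_subset[OF _ finite_lists_eq[of n]]) auto
      have "0 = Poly_Mapping.lookup ?p (exponents ks)"
        using lookup_poly_upto[OF low, of "exponents ks"] ks by (simp add: monomial_degree_exponents)
      also have "\<dots> = (\<Sum>js | length js = n. if mset js = mset ks then \<zeta> (map f js) else 0)"
        by (auto simp: lookup_sum lookup_monomial exponents_eq_iff scaleC_complex_def intro!: sum.cong)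
      also have "\<dots> = (\<Sum>js\<in>?C. \<zeta> (map f js))"
        by (subst sum.inter_filter[symmetric, OF finite_lists_eq]) simp
      also have "\<dots> = (\<Sum>js\<in>?C. \<zeta> (map f ks))"
        by (intro sum.cong[OF refl] symmetricD[OF symmetric_sym_power[OF \<zeta>]]) auto
      also have "\<dots> = of_nat (card ?C) * \<zeta> (map f ks)"
        by simp
      finally have "card ?C = 0 \<or> \<zeta> (map f ks) = 0" by simp
      with fin ks show ?thesis by auto
    qed
    then show "\<zeta> = 0"
      by (subst sym_power_expansion[OF \<zeta>]) simp
  qed
  have "inj_on (jacobi_U P n e) (sym_power n)"
  proof (rule inj_onI)
    fix \<xi> \<eta> :: "'v tensor"
    assume \<xi>: "\<xi> \<in> sym_power n" and \<eta>: "\<eta> \<in> sym_power n"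
      and eq: "jacobi_U P n e \<xi> = jacobi_U P n e \<eta>"
    have "\<xi> - \<eta> \<in> sym_power n"
      using \<xi> \<eta> by (rule complex_vector.subspace_diff[OF csubspace_sym_power])
    moreover have "jacobi_U P n e (\<xi> - \<eta>) = 0"
      using clinear_on_add[OF lin \<open>\<xi> - \<eta> \<in> sym_power n\<close> \<eta>] eq by simp
    ultimately show "\<xi> = \<eta>" using inj0 by fastforce
  qed
  moreover have "jacobi_U P n e ` sym_power n = P n"
  proof
    show "jacobi_U P n e ` sym_power n \<subseteq> P n"
    proof
      fix p assume "p \<in> jacobi_U P n e ` sym_power n"
      then obtain \<xi> where \<xi>: "\<xi> \<in> sym_power n" "p = jacobi_U P n e \<xi>" by blast
      show "p \<in> P n"
        unfolding \<xi>(2) formula[OF \<xi>(1)] using foldr_a_plus_mem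
        by (intro complex_vector.subspace_sum complex_vector.subspace_scale csubspace_P) auto
    qed
    have "decomp_proj P n p \<in> jacobi_U P n e ` sym_power n" if "p \<in> poly_upto (int n)" for p
      using that unfolding poly_upto_def
    proof (induction rule: complex_vector.span_induct_alt)
      case base
      have "jacobi_U P n e 0 = 0"
        using clinear_on_scaleC[OF lin complex_vector.subspace_0[OF csubspace_sym_power], of 0] by simp
      then show ?case
        using complex_vector.subspace_0[OF csubspace_sym_power, of n]
        by (metis clinear_zero[OF clinear_decomp_proj] image_eqI)
    next
      case (step c x y)
      then obtain m \<eta> where m: "x = monomial m" "monomial_degree m \<le> n"
        and \<eta>: "\<eta> \<in> sym_power n" "decomp_proj P n y = jacobi_U P n e \<eta>"
        by auto
      have proj: "decomp_proj P n (c *\<^sub>C x + y) = c *\<^sub>C decomp_proj P n x + jacobi_U P n e \<eta>"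
        by (simp add: clinear_add[OF clinear_decomp_proj] clinear_scaleC[OF clinear_decomp_proj] \<eta>)
      show ?case
      proof (cases "monomial_degree m = n")
        case False
        with m have "decomp_proj P n x = 0"
          by (intro decomp_proj_lower) (simp add: monomial_in_poly_upto)
        with proj \<eta> show ?thesis by auto
      next
        case True
        obtain js where js: "exponents js = m" "length js = n"
          using ex_exponents[of m] True by metis
        have "decomp_proj P n x = decomp_proj P n (foldr (a_plus P) js 1)"
          using foldr_a_plus_congruent[of js] js m(1) by (intro decomp_proj_cong) simp
        also have "\<dots> = jacobi_U P n e (sym_tensor (map e js))"
          using decomp_proj_P[OF foldr_a_plus_mem[of js]] js(2) val[of "map e js"]
          by (simp add: foldr_basis)
        finally have "decomp_proj P n (c *\<^sub>C x + y) =
            jacobi_U P n e (c *\<^sub>C sym_tensor (map e js) + \<eta>)"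
          using \<eta>(1) js(2) unfolding proj
          by (simp add: clinear_on_add[OF lin] clinear_on_scaleC[OF lin] sym_tensor_in_sym_power
              complex_vector.subspace_scale csubspace_sym_power)
        then show ?thesis
          using \<eta>(1) js(2)
          by (simp add: sym_tensor_in_sym_power complex_vector.subspace_add
              complex_vector.subspace_scale csubspace_sym_power)
      qed
    qed
    then show "P n \<subseteq> jacobi_U P n e ` sym_power n"
      using decomp_proj_P P_subset_poly_upto[of n] by fastforce
  qed
  ultimately show "bij_betw (jacobi_U P n e) (sym_power n) (P n)"
    by (simp add: bij_betw_def)
qed

end

section \<open>Change of basis\<close>

lemma lookup_poly_star: "Poly_Mapping.lookup (poly_star p) m = cnj (Poly_Mapping.lookup p m)"
  by (simp add: poly_star_def map.rep_eq when_def)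

lemma sesquilinear_pre_inner:
  fixes \<phi> :: "'d::finite cpoly \<Rightarrow> complex"
  assumes "clinear \<phi>"
  shows "sesquilinear_on UNIV (pre_inner \<phi>)"
proof -
  have "poly_star (p + q) = poly_star p + poly_star q"
    and "poly_star (c *\<^sub>C p) = cnj c *\<^sub>C poly_star p" for p q :: "'d cpoly" and c
    by (auto intro!: poly_mapping_eqI simp: lookup_poly_star lookup_add scaleC_complex_def)
  moreover have "(c *\<^sub>C p) * q = c *\<^sub>C (p * q)" "p * (c *\<^sub>C q) = c *\<^sub>C (p * q)"
    for p q :: "'d cpoly" and c
    by (simp_all add: scaleC_poly_eq mult.assoc mult.left_commute)
  ultimately show ?thesis
    by (simp add: sesquilinear_on_def pre_inner_def clinear_add[OF assms] clinear_scaleC[OF assms]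
        distrib_left distrib_right scaleC_complex_def)
qed

lemma sesquilinear_on_pullback:
  assumes "sesquilinear_on T B" "clinear_on S T f"
  shows "sesquilinear_on S (\<lambda>x y. B (f x) (f y))"
  using assms by (auto simp: sesquilinear_on_def clinear_on_def Pi_iff)

text \<open>\<open>R\<close> carries the \<open>e\<close>-expansion of \<open>v\<close> to the \<open>e'\<close>-expansion of \<open>R v\<close>, so that
  \<open>a\<^sup>+\<close> of \<open>v\<close> with respect to \<open>e\<close> is \<open>a\<^sup>+\<close> of \<open>R v\<close> with respect to \<open>e'\<close>.\<close>

lemma coord_change_basis:
  assumes e: "is_basis e" and e': "is_basis e'" and R: "clinear R" and Re: "\<And>i. R (e i) = e' i"
  shows "coord e' (R v) j = coord e v j"
proof -
  have "R v = (\<Sum>i\<in>UNIV. coord e v i *\<^sub>C e' i)"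
    by (subst coord_expansion[OF e, of v]) (simp add: clinear_sum[OF R] clinear_scaleC[OF R] Re)
  then show ?thesis
    by (simp add: clinear_sum[OF coord_clinear[OF e']] clinear_scaleC[OF coord_clinear[OF e']]
        coord_basis[OF e'] scaleC_complex_def if_distrib cong: if_cong)
qed

context dual_pair
begin

lemma
  fixes R :: "'v \<Rightarrow> 'v"
  assumes R: "clinear R"
  shows clinear_on_sym_map: "clinear_on (sym_power n) (sym_power n) (sym_map n R)"
    and sym_map_sym_tensor: "length vs = n \<Longrightarrow> sym_map n R (sym_tensor vs) = sym_tensor (map R vs)"
proof -
  have ml: "multilinear n (\<lambda>vs. sym_tensor (map R vs))"
    unfolding multilinear_def
  proof (intro allI impI)
    fix xs ys :: "'v list" assume "length xs + length ys + 1 = n"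
    then have "clinear (\<lambda>v. sym_tensor (map R xs @ v # map R ys))"
      by (intro multilinearD[OF multilinear_sym_tensor]) simp
    from clinear_compose[OF this R] show "clinear (\<lambda>v. sym_tensor (map R (xs @ v # ys)))"
      by simp
  qed
  have sym: "symmetric n (\<lambda>vs. sym_tensor (map R vs))"
    unfolding symmetric_def
    by (auto intro!: symmetricD[OF symmetric_sym_tensor[of n]])
  show "length vs = n \<Longrightarrow> sym_map n R (sym_tensor vs) = sym_tensor (map R vs)"
    unfolding sym_map_def by (rule sym_lift_sym_tensor[OF ml sym])
  have "sym_map n R \<xi> \<in> sym_power n" if "\<xi> \<in> sym_power n" for \<xi>
    unfolding sym_map_def sym_lift_eq[OF ml sym that]
    by (intro sum_in_sym_power sym_tensor_in_sym_power) simp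
  then show "clinear_on (sym_power n) (sym_power n) (sym_map n R)"
    using clinear_on_sym_lift[OF ml sym] by (auto simp: clinear_on_def sym_map_def)
qed

lemma
  assumes T: "clinear_on (sym_power n) (sym_power n) (T :: 'v tensor \<Rightarrow> 'v tensor)"
  shows sym_adjoint_mem: "\<eta> \<in> sym_power n \<Longrightarrow> sym_adjoint n T \<eta> \<in> sym_power n"
    and sym_inner_sym_adjoint: "\<xi> \<in> sym_power n \<Longrightarrow> \<eta> \<in> sym_power n \<Longrightarrow>
      sym_inner n \<xi> (sym_adjoint n T \<eta>) = sym_inner n (T \<xi>) \<eta>"
proof -
  have "sesquilinear_on (sym_power n) (\<lambda>\<xi> \<eta>. sym_inner n (T \<xi>) \<eta>)"
    using sesquilinear_sym_inner[of n] T by (auto simp: sesquilinear_on_def clinear_on_def Pi_iff)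
  note ex1 = ex1_operator_of_sesquilinear[OF this]
  \<comment> \<open>the two sides of the defining equation are exchanged, to match the representation lemma\<close>
  have "sym_adjoint n T = (THE T'. T' \<in> extensional (sym_power n) \<and>
      clinear_on (sym_power n) (sym_power n) T' \<and>
      (\<forall>\<xi>\<in>sym_power n. \<forall>\<eta>\<in>sym_power n. sym_inner n \<xi> (T' \<eta>) = sym_inner n (T \<xi>) \<eta>))"
    unfolding sym_adjoint_def by (rule arg_cong[where f = The], rule ext) metis
  with theI'[OF ex1]
  have "clinear_on (sym_power n) (sym_power n) (sym_adjoint n T) \<and>
      (\<forall>\<xi>\<in>sym_power n. \<forall>\<eta>\<in>sym_power n. sym_inner n \<xi> (sym_adjoint n T \<eta>) = sym_inner n (T \<xi>) \<eta>)"
    by simp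
  then show "\<eta> \<in> sym_power n \<Longrightarrow> sym_adjoint n T \<eta> \<in> sym_power n"
    and "\<xi> \<in> sym_power n \<Longrightarrow> \<eta> \<in> sym_power n \<Longrightarrow>
      sym_inner n \<xi> (sym_adjoint n T \<eta>) = sym_inner n (T \<xi>) \<eta>"
    using clinear_on_imp_mem by auto
qed

end

context graded_polynomials
begin

lemma
  fixes e :: "'d \<Rightarrow> 'v::complex_inner"
  assumes \<phi>: "clinear \<phi>" and e: "is_basis e"
  shows jacobi_Omega_mem: "\<eta> \<in> sym_power n \<Longrightarrow> jacobi_Omega \<phi> P n e \<eta> \<in> sym_power n"
    and sym_inner_jacobi_Omega: "\<xi> \<in> sym_power n \<Longrightarrow> \<eta> \<in> sym_power n \<Longrightarrow>
      sym_inner n \<xi> (jacobi_Omega \<phi> P n e \<eta>) =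
        pre_inner \<phi> (jacobi_U P n e \<xi>) (jacobi_U P n e \<eta>)"
proof -
  obtain f where "dual_pair e f" using ex_dual_pair[OF e] .
  then interpret dual_pair e f .
  have "sesquilinear_on (sym_power n) (\<lambda>\<xi> \<eta>. pre_inner \<phi> (jacobi_U P n e \<xi>) (jacobi_U P n e \<eta>))"
    by (rule sesquilinear_on_pullback[OF sesquilinear_pre_inner[OF \<phi>] clinear_on_jacobi_U[OF e]])
  from theI'[OF ex1_operator_of_sesquilinear[OF this]]
  have "clinear_on (sym_power n) (sym_power n) (jacobi_Omega \<phi> P n e) \<and>
      (\<forall>\<xi>\<in>sym_power n. \<forall>\<eta>\<in>sym_power n. sym_inner n \<xi> (jacobi_Omega \<phi> P n e \<eta>) =
        pre_inner \<phi> (jacobi_U P n e \<xi>) (jacobi_U P n e \<eta>))"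
    unfolding jacobi_Omega_def by blast
  then show "\<eta> \<in> sym_power n \<Longrightarrow> jacobi_Omega \<phi> P n e \<eta> \<in> sym_power n"
    and "\<xi> \<in> sym_power n \<Longrightarrow> \<eta> \<in> sym_power n \<Longrightarrow> sym_inner n \<xi> (jacobi_Omega \<phi> P n e \<eta>) =
        pre_inner \<phi> (jacobi_U P n e \<xi>) (jacobi_U P n e \<eta>)"
    using clinear_on_imp_mem by auto
qed

text \<open>On symmetric tensor products this is the equality of the creation operators of \<open>v\<close> and
  \<open>R v\<close>. All dependence on the basis enters the main theorem through this relation.\<close>

lemma jacobi_U_change_basis:
  fixes e e' :: "'d \<Rightarrow> 'v::complex_inner"
  assumes e: "is_basis e" and e': "is_basis e'" and R: "clinear R" and Re: "\<And>i. R (e i) = e' i"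
    and \<xi>: "\<xi> \<in> sym_power n"
  shows "jacobi_U P n e' (sym_map n R \<xi>) = jacobi_U P n e \<xi>"
proof -
  obtain f where "dual_pair e f" using ex_dual_pair[OF e] .
  then interpret dual_pair e f .
  have "a_plus_vec P e' (R v) = a_plus_vec P e v" for v
    by (simp add: fun_eq_iff a_plus_vec_def coord_change_basis[OF e e' R Re])
  then have "jacobi_U P n e' (sym_map n R (sym_tensor vs)) = jacobi_U P n e (sym_tensor vs)"
    if "length vs = n" for vs
    using that
    by (simp add: sym_map_sym_tensor[OF R] jacobi_U_sym_tensor[OF e] jacobi_U_sym_tensor[OF e']
        foldr_map comp_def)
  then show ?thesis
    by (rule sym_power_clinear_eq[OF clinear_on_compose[OF clinear_on_sym_map[OF R]
          clinear_on_jacobi_U[OF e']] clinear_on_jacobi_U[OF e] _ \<xi>])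
qed

end

theorem theorem4:
  fixes \<phi> :: "'d::finite cpoly \<Rightarrow> complex"
    and P :: "nat \<Rightarrow> 'd cpoly set"
    and e e' :: "'d \<Rightarrow> 'v::complex_inner"
    and R :: "'v \<Rightarrow> 'v"
    and n :: nat and j :: 'd
  assumes "is_state \<phi>"
    and "is_orthogonal_decomposition \<phi> P"
    and "cdim (UNIV :: 'v set) = CARD('d)"
    and "is_basis e" and "is_basis e'"
    and "clinear R" and "\<And>i. R (e i) = e' i"
    and "n \<ge> 1"
  shows "(\<forall>\<xi>\<in>sym_power n.
            jacobi_Omega \<phi> P n e \<xi> =
              sym_adjoint n (sym_map n R) (jacobi_Omega \<phi> P n e' (sym_map n R \<xi>))) \<and>
         (\<forall>\<xi>\<in>sym_power n.
            jacobi_alpha P n e' j \<xi> =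
              sym_map n R (jacobi_alpha P n e j (inv_into (sym_power n) (sym_map n R) \<xi>)))"
proof -
  note e = \<open>is_basis e\<close> and e' = \<open>is_basis e'\<close> and R = \<open>clinear R\<close>
  have \<phi>: "clinear \<phi>" using assms(1) by (simp add: is_state_def)
  interpret graded_polynomials P
    using assms(2) by unfold_locales (auto simp: is_orthogonal_decomposition_def)
  obtain f where "dual_pair e f" using ex_dual_pair[OF e] .
  then interpret dual_pair e f .
  let ?S = "sym_power n :: 'v tensor set" and ?T = "sym_map n R"
  let ?U = "jacobi_U P n e" and ?U' = "jacobi_U P n e'"
  have T: "clinear_on ?S ?S ?T" by (rule clinear_on_sym_map[OF R])
  have T_mem: "?T \<xi> \<in> ?S" if "\<xi> \<in> ?S" for \<xi>
    by (rule clinear_on_imp_mem[OF T that])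
  have UT: "?U' (?T \<xi>) = ?U \<xi>" if "\<xi> \<in> ?S" for \<xi>
    by (rule jacobi_U_change_basis[OF e e' R assms(7) that])
  have U: "bij_betw ?U ?S (P n)" and U': "bij_betw ?U' ?S (P n)"
    using bij_betw_jacobi_U e e' by blast+
  have "jacobi_Omega \<phi> P n e \<eta> = sym_adjoint n ?T (jacobi_Omega \<phi> P n e' (?T \<eta>))"
    if \<eta>: "\<eta> \<in> ?S" for \<eta>
  proof (rule sym_inner_nondegenerate)
    have \<Omega>': "jacobi_Omega \<phi> P n e' (?T \<eta>) \<in> ?S"
      by (rule jacobi_Omega_mem[OF \<phi> e' T_mem[OF \<eta>]])
    show "jacobi_Omega \<phi> P n e \<eta> \<in> ?S"
      by (rule jacobi_Omega_mem[OF \<phi> e \<eta>])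
    show "sym_adjoint n ?T (jacobi_Omega \<phi> P n e' (?T \<eta>)) \<in> ?S"
      by (rule sym_adjoint_mem[OF T \<Omega>'])
    fix \<xi> assume \<xi>: "\<xi> \<in> ?S"
    show "sym_inner n \<xi> (jacobi_Omega \<phi> P n e \<eta>) =
        sym_inner n \<xi> (sym_adjoint n ?T (jacobi_Omega \<phi> P n e' (?T \<eta>)))"
      by (simp only: sym_inner_sym_adjoint[OF T \<xi> \<Omega>'] sym_inner_jacobi_Omega[OF \<phi> e \<xi> \<eta>]
          sym_inner_jacobi_Omega[OF \<phi> e' T_mem[OF \<xi>] T_mem[OF \<eta>]] UT[OF \<xi>] UT[OF \<eta>])
  qed
  moreover have "jacobi_alpha P n e' j \<xi> = ?T (jacobi_alpha P n e j (inv_into ?S ?T \<xi>))"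
    if \<xi>: "\<xi> \<in> ?S" for \<xi>
  proof -
    obtain \<eta> where \<eta>: "\<eta> \<in> ?S" "?U \<eta> = ?U' \<xi>"
      using U U' \<xi> by (metis bij_betw_apply bij_betw_imp_surj_on imageE)
    then have T\<eta>: "?T \<eta> = \<xi>"
      using UT[OF \<eta>(1)] U' \<xi> T_mem by (metis bij_betw_imp_inj_on inj_onD)
    \<comment> \<open>injectivity is inherited from \<open>?U = ?U' \<circ> ?T\<close>\<close>
    have "inj_on ?T ?S"
      using U UT by (metis bij_betw_imp_inj_on inj_on_def)
    then have inv: "inv_into ?S ?T \<xi> = \<eta>"
      using T\<eta> \<eta>(1) by (simp add: inv_into_f_eq)
    let ?q = "a_zero_n P j n (?U \<eta>)" and ?\<zeta> = "jacobi_alpha P n e j \<eta>"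
    have "?q \<in> P n" by (simp add: a_zero_n_def decomp_proj_mem)
    then have \<zeta>: "?\<zeta> \<in> ?S" "?U ?\<zeta> = ?q"
      using U unfolding jacobi_alpha_def
      by (simp_all add: bij_betw_imp_surj_on inv_into_into f_inv_into_f)
    have "jacobi_alpha P n e' j \<xi> = inv_into ?S ?U' ?q"
      by (simp add: jacobi_alpha_def \<eta>(2))
    also have "\<dots> = ?T ?\<zeta>"
      using U' UT[OF \<zeta>(1)] \<zeta> T_mem
      by (intro inv_into_f_eq) (simp_all add: bij_betw_imp_inj_on)
    finally show ?thesis by (simp add: inv)
  qed
  ultimately show ?thesis by blast
qed

end
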